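(* Let $k \ge 2$ be an integer and let $G$ be a connected balanced bipartite simple graph of order $n \ge 4k+8$ with minimum degree $\delta \ge k+2$. If \[ \rho_D(G) \le \rho_D\left(K_{\frac{n}{2}, \frac{n}{2}} \setminus E\left(K_{1, \frac{n}{2}-k+1}\right)\right), \] then $G$ has property $P(k, \delta)$.
   Context: All graphs are finite, undirected and simple. A bipartite graph is balanced if its two parts have equal size (so $n$ is even). For a connected graph $G$ with vertices $v_1,\dots,v_n$, the distance matrix $D(G)$ is the $n\times n$ matrix whose $(i,j)$-entry is the length of a shortest path between $v_i$ and $v_j$; $\rho_D(G)$ denotes its largest eigenvalue (the distance spectral radius). $K_{m,m}$ is the complete bipartite graph with $m$ vertices in each part, and $K_{\frac{n}{2}, \frac{n}{2}} \setminus E(K_{1, \frac{n}{2}-k+1})$ is the graph obtained from $K_{\frac n2,\frac n2}$ by deleting the edges of a star $K_{1,\frac n2-k+1}$ in it (i.e., deleting $\frac n2 - k+1$ edges incident to one fixed vertex). For positive integers $k,d$, a graph $G$ of order $n$ has property $P(k,d)$ if: (a) $G$ contains $k$ edge-disjoint spanning trees; (b) there is a forest $F$ in $G$, edge-disjoint from these $k$ spanning trees, with $|E(F)| > \frac{d-1}{d}(n-1)$; and (c) if $F$ is not a spanning tree, then $F$ has a component with at least $d$ edges. *)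

theory Defs
  imports Complex_Main "Jordan_Normal_Form.Char_Poly"
begin

text \<open>
  Graphs are undirected, with edges given as two-element sets of vertices, so that the number of
  edges is a plain cardinality and edge-disjointness is disjointness of sets.
\<close>

record 'a ugraph =
  verts :: "'a set"
  edges :: "'a set set"

definition simple_graph :: "'a ugraph \<Rightarrow> bool" where
  "simple_graph G \<longleftrightarrow> finite (verts G) \<and> (\<forall>e\<in>edges G. e \<subseteq> verts G \<and> card e = 2)"

definition subgraph_of :: "'a ugraph \<Rightarrow> 'a ugraph \<Rightarrow> bool" where
  "subgraph_of H G \<longleftrightarrow> simple_graph H \<and> verts H \<subseteq> verts G \<and> edges H \<subseteq> edges G"

text \<open>A path is the list of its vertices; it has one edge fewer than it has vertices.\<close>

definition path_between :: "'a ugraph \<Rightarrow> 'a \<Rightarrow> 'a list \<Rightarrow> 'a \<Rightarrow> bool" where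
  "path_between G u p v \<longleftrightarrow>
     p \<noteq> [] \<and> hd p = u \<and> last p = v \<and> distinct p \<and> set p \<subseteq> verts G \<and>
     (\<forall>i. Suc i < length p \<longrightarrow> {p ! i, p ! Suc i} \<in> edges G)"

definition connected_graph :: "'a ugraph \<Rightarrow> bool" where
  "connected_graph G \<longleftrightarrow>
     verts G \<noteq> {} \<and> (\<forall>u\<in>verts G. \<forall>v\<in>verts G. \<exists>p. path_between G u p v)"

definition is_cycle :: "'a ugraph \<Rightarrow> 'a list \<Rightarrow> bool" where
  "is_cycle G p \<longleftrightarrow>
     3 \<le> length p \<and> path_between G (hd p) p (last p) \<and> {last p, hd p} \<in> edges G"

definition acyclic_graph :: "'a ugraph \<Rightarrow> bool" where
  "acyclic_graph G \<longleftrightarrow> \<not> (\<exists>p. is_cycle G p)"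

definition spanning_tree_of :: "'a ugraph \<Rightarrow> 'a ugraph \<Rightarrow> bool" where
  "spanning_tree_of T G \<longleftrightarrow>
     subgraph_of T G \<and> verts T = verts G \<and> connected_graph T \<and> acyclic_graph T"

definition component_of :: "'a ugraph \<Rightarrow> 'a ugraph \<Rightarrow> bool" where
  "component_of C G \<longleftrightarrow>
     subgraph_of C G \<and> connected_graph C \<and>
     (\<forall>C'. subgraph_of C' G \<and> connected_graph C' \<and> subgraph_of C C' \<longrightarrow> C' = C)"

definition vertex_degree :: "'a ugraph \<Rightarrow> 'a \<Rightarrow> nat" where
  "vertex_degree G v = card {e \<in> edges G. v \<in> e}"

definition min_degree :: "'a ugraph \<Rightarrow> nat" where
  "min_degree G = Min (vertex_degree G ` verts G)"

definition balanced_bipartite :: "'a ugraph \<Rightarrow> bool" where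
  "balanced_bipartite G \<longleftrightarrow>
     (\<exists>A B. A \<union> B = verts G \<and> A \<inter> B = {} \<and> card A = card B \<and>
        (\<forall>e\<in>edges G. \<exists>a\<in>A. \<exists>b\<in>B. e = {a, b}))"

definition graph_dist :: "'a ugraph \<Rightarrow> 'a \<Rightarrow> 'a \<Rightarrow> nat" where
  "graph_dist G u v = (LEAST l. \<exists>p. path_between G u p v \<and> length p = Suc l)"

text \<open>
  The matrix depends on the chosen enumeration of the vertices only up to simultaneous permutation
  of rows and columns, so its eigenvalues do not depend on the choice.
\<close>

definition vertex_enum :: "'a ugraph \<Rightarrow> 'a list" where
  "vertex_enum G = (SOME vs. distinct vs \<and> set vs = verts G)"

definition distance_matrix :: "'a ugraph \<Rightarrow> real mat" where
  "distance_matrix G =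
     mat (card (verts G)) (card (verts G))
       (\<lambda>(i, j). real (graph_dist G (vertex_enum G ! i) (vertex_enum G ! j)))"

definition distance_spectral_radius :: "'a ugraph \<Rightarrow> real" where
  "distance_spectral_radius G = Max {x. eigenvalue (distance_matrix G) x}"

definition complete_bipartite :: "'a set \<Rightarrow> 'a set \<Rightarrow> 'a ugraph" where
  "complete_bipartite A B = \<lparr>verts = A \<union> B, edges = {{a, b} | a b. a \<in> A \<and> b \<in> B}\<rparr>"

definition delete_edges :: "'a ugraph \<Rightarrow> 'a set set \<Rightarrow> 'a ugraph" where
  "delete_edges G S = \<lparr>verts = verts G, edges = edges G - S\<rparr>"

text \<open>
  $K_{m,m}$ with parts $\{0,\dots,m-1\}$ and $\{m,\dots,2m-1\}$, minus the edges of the star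
  $K_{1,r}$ with centre $0$ and leaves $m,\dots,m+r-1$; meaningful for $r \leq m$.
\<close>

definition bipartite_minus_star :: "nat \<Rightarrow> nat \<Rightarrow> nat ugraph" where
  "bipartite_minus_star m r =
     delete_edges (complete_bipartite {0..<m} {m..<2 * m})
       (edges (complete_bipartite {0} {m..<m + r}))"

definition property_P :: "nat \<Rightarrow> nat \<Rightarrow> 'a ugraph \<Rightarrow> bool" where
  "property_P k d G \<longleftrightarrow>
     (\<exists>T F.
        (\<forall>i<k. spanning_tree_of (T i) G) \<and>
        (\<forall>i<k. \<forall>j<k. i \<noteq> j \<longrightarrow> edges (T i) \<inter> edges (T j) = {}) \<and>
        subgraph_of F G \<and> acyclic_graph F \<and>
        (\<forall>i<k. edges F \<inter> edges (T i) = {}) \<and>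
        real (card (edges F)) > (real d - 1) / real d * (real (card (verts G)) - 1) \<and>
        (\<not> spanning_tree_of F G \<longrightarrow> (\<exists>C. component_of C F \<and> d \<le> card (edges C))))"

end

theory Submission
  imports Defs "HOL-Analysis.Function_Topology"
begin

text \<open>
  Let \<open>m = n / 2\<close>. A positive test vector bounds the distance spectral radius of the extremal graph
  by \<open>3 m + 1\<close>, while the Rayleigh quotient of the all-ones vector bounds that of \<open>G\<close> below by
  \<open>3 m - 2 + 2 q / m\<close>, where \<open>q\<close> is the number of edges of \<open>K\<^bsub>m,m\<^esub>\<close> missing in \<open>G\<close>. Hence
  \<open>2 q \<le> 3 m\<close>, and with minimum degree at least \<open>k + 2\<close> every partition of the vertices into \<open>p\<close>
  parts is crossed by at least \<open>(k + 1) (p - 1)\<close> edges. By the tree-packing theorem of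
  Nash-Williams and Tutte, \<open>G\<close> has \<open>k + 1\<close> edge-disjoint spanning trees, the last of which serves
  as the forest \<open>F\<close>.

  The tree-packing theorem is obtained from a packing of forests with the maximum number of edges
  by considering all packings reachable from it through exchanges with uncovered edges.
\<close>

section \<open>Forests and connectivity\<close>

text \<open>Two obstacles shape the argument. For the extremal graph with \<open>r\<close> deleted
  edges the all-ones vector is useless as an upper bound: the row sum at the centre is 3m - 2 + 2r,
  about 5m when \<open>r\<close> is close to \<open>m\<close>. The test vector therefore has to be
  heavier at the centre. For \<open>G\<close>, up to 3m/2 missing edges could isolate a vertex,
  while a degree bound alone does not control partitions into large parts. So a partition with one
  huge part is handled by degrees and every other partition by counting edges inside the parts; the
  constant 3/2 is small enough for these two ranges to meet.

  In the tree packing a swap changes which edges are uncovered, hence which swaps come next. Closing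
  under all swaps yields one edge set in which every forest has the same connectivity classes as the
  whole set. These classes are the single partition to which the cut hypothesis is applied.\<close>

definition linked :: "'a set set \<Rightarrow> ('a \<times> 'a) set" where
  "linked S = {(x, y). {x, y} \<in> S}\<^sup>*"

lemma linked_refl [simp]: "(x, x) \<in> linked S"
  by (simp add: linked_def)

lemma linked_edge: "{x, y} \<in> S \<Longrightarrow> (x, y) \<in> linked S"
  by (auto simp: linked_def)

lemma linked_sym: "(x, y) \<in> linked S \<Longrightarrow> (y, x) \<in> linked S"
proof -
  have "sym {(x, y). {x, y} \<in> S}"
    by (auto simp: sym_def insert_commute)
  then show "(x, y) \<in> linked S \<Longrightarrow> (y, x) \<in> linked S"
    unfolding linked_def by (meson sym_rtrancl symD)
qed

lemma linked_trans: "(x, y) \<in> linked S \<Longrightarrow> (y, z) \<in> linked S \<Longrightarrow> (x, z) \<in> linked S"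
  unfolding linked_def by (rule rtrancl_trans)

lemma linked_subset_linked:
  assumes "\<And>u v. {u, v} \<in> S \<Longrightarrow> (u, v) \<in> linked T"
  shows "linked S \<subseteq> linked T"
proof -
  have "{(x, y). {x, y} \<in> S}\<^sup>* \<subseteq> ({(x, y). {x, y} \<in> T}\<^sup>*)\<^sup>*"
    using assms by (intro rtrancl_mono) (auto simp: linked_def)
  then show ?thesis by (simp add: linked_def)
qed

lemma linked_mono: "S \<subseteq> T \<Longrightarrow> linked S \<subseteq> linked T"
  by (rule linked_subset_linked) (auto intro: linked_edge)

lemma linked_insertD:
  assumes "(x, y) \<in> linked (insert {u, v} S)"
  shows "(x, y) \<in> linked S \<or> (x, u) \<in> linked S \<and> (v, y) \<in> linked S \<or>
    (x, v) \<in> linked S \<and> (u, y) \<in> linked S"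
  using assms[unfolded linked_def]
proof (induction rule: rtrancl_induct)
  case base
  then show ?case by simp
next
  case (step y z)
  have IH: "(x, y) \<in> linked S \<or> (x, u) \<in> linked S \<and> (v, y) \<in> linked S \<or>
    (x, v) \<in> linked S \<and> (u, y) \<in> linked S"
    using step.IH by (simp add: linked_def)
  have "{y, z} = {u, v} \<or> {y, z} \<in> S" using step.hyps(2) by auto
  then have "y = u \<and> z = v \<or> y = v \<and> z = u \<or> (y, z) \<in> linked S"
    by (auto simp: doubleton_eq_iff intro: linked_edge)
  then have "(x, z) \<in> linked S \<or> (x, u) \<in> linked S \<and> (v, z) \<in> linked S \<or>
    (x, v) \<in> linked S \<and> (u, z) \<in> linked S"
    using IH linked_trans linked_refl by metis
  then show ?case by (simp add: linked_def)
qed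

text \<open>A link from \<open>u\<close> to \<open>v\<close> that needs \<open>xy\<close> passes
  through it; closing this link by \<open>uv\<close> gives a cycle whose remaining part joins
  \<open>x\<close> to \<open>y\<close>. This is the exchange property of the graphic matroid, which
  drives the swaps below.\<close>

lemma linked_exchange:
  assumes "(u, v) \<in> linked (insert {x, y} S)" "(u, v) \<notin> linked S"
  shows "(x, y) \<in> linked (insert {u, v} S)"
proof -
  have sub: "linked S \<subseteq> linked (insert {u, v} S)" by (rule linked_mono) auto
  have uv: "(u, v) \<in> linked (insert {u, v} S)" by (rule linked_edge) simp
  consider "(u, x) \<in> linked S" "(y, v) \<in> linked S" | "(u, y) \<in> linked S" "(x, v) \<in> linked S"
    using linked_insertD[OF assms(1)] assms(2) by blast
  then show ?thesis
    using sub uv by cases (meson linked_sym linked_trans subsetD)+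
qed

text \<open>Acyclicity in the form "every edge is a bridge", so that no cycle has to be handled as a
  list. As \<open>linked\<close> is reflexive, this also excludes singletons from
  \<open>S\<close>.\<close>

definition forest :: "'a set set \<Rightarrow> bool" where
  "forest S \<longleftrightarrow> (\<forall>u v. {u, v} \<in> S \<longrightarrow> (u, v) \<notin> linked (S - {{u, v}}))"

lemma forest_subset:
  assumes "forest S" "T \<subseteq> S"
  shows "forest T"
  unfolding forest_def
proof (intro allI impI notI)
  fix u v assume e: "{u, v} \<in> T" "(u, v) \<in> linked (T - {{u, v}})"
  have "linked (T - {{u, v}}) \<subseteq> linked (S - {{u, v}})"
    using assms(2) by (intro linked_mono) auto
  then show False using assms e unfolding forest_def by blast
qed

text \<open>A new cycle through an old edge \<open>xy\<close> would have to use \<open>uv\<close>,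
  and \<open>linked_exchange\<close> would then link \<open>u\<close> and \<open>v\<close> inside
  the old forest.\<close>

lemma forest_insert:
  assumes "forest S" "(u, v) \<notin> linked S"
  shows "forest (insert {u, v} S)"
  unfolding forest_def
proof (intro allI impI notI)
  fix x y assume e: "{x, y} \<in> insert {u, v} S"
    and l: "(x, y) \<in> linked (insert {u, v} S - {{x, y}})"
  show False
  proof (cases "{x, y} = {u, v}")
    case True
    have "linked (insert {u, v} S - {{x, y}}) \<subseteq> linked S"
      using True by (intro linked_mono) auto
    then have "(x, y) \<in> linked S" using l by blast
    then show False
      using True assms(2) linked_sym by (metis doubleton_eq_iff)
  next
    case False
    then have S: "{x, y} \<in> S" using e by simp
    have "insert {u, v} S - {{x, y}} = insert {u, v} (S - {{x, y}})" using False by auto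
    then have "(x, y) \<in> linked (insert {u, v} (S - {{x, y}}))" using l by simp
    moreover have "(x, y) \<notin> linked (S - {{x, y}})" using assms(1) S by (simp add: forest_def)
    ultimately have "(u, v) \<in> linked (insert {x, y} (S - {{x, y}}))"
      by (rule linked_exchange)
    then show False using assms(2) S by (simp add: insert_absorb)
  qed
qed

section \<open>Connectivity classes and their number\<close>

definition comps :: "'a set \<Rightarrow> 'a set set \<Rightarrow> 'a set set" where
  "comps V S = (\<lambda>v. linked S `` {v}) ` V"

lemma linked_class_eq_iff: "linked S `` {u} = linked S `` {v} \<longleftrightarrow> (u, v) \<in> linked S"
proof
  assume "linked S `` {u} = linked S `` {v}"
  moreover have "v \<in> linked S `` {v}" by simp
  ultimately show "(u, v) \<in> linked S" by blast
next
  assume "(u, v) \<in> linked S"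
  then show "linked S `` {u} = linked S `` {v}"
    using linked_sym[of u v S] linked_trans[of u v S] linked_trans[of v u S] by blast
qed

text \<open>The classes of \<open>u\<close> and \<open>v\<close> are replaced by their union and all
  other classes stay as they are.\<close>

lemma card_comps_insert:
  assumes "finite V" "u \<in> V" "v \<in> V" "(u, v) \<notin> linked S"
  shows "card (comps V S) = Suc (card (comps V (insert {u, v} S)))"
proof -
  define c where "c w = linked S `` {w}" for w
  define d where "d w = linked (insert {u, v} S) `` {w}" for w
  have uv: "(u, v) \<in> linked (insert {u, v} S)" by (rule linked_edge) simp
  have sub: "linked S \<subseteq> linked (insert {u, v} S)" by (rule linked_mono) auto
  have c_eq: "c x = c y \<longleftrightarrow> (x, y) \<in> linked S" for x y
    unfolding c_def by (rule linked_class_eq_iff)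
  have d_u: "d u = c u \<union> c v"
  proof
    show "d u \<subseteq> c u \<union> c v"
      unfolding c_def d_def using linked_insertD[of u _ u v S] by blast
    show "c u \<union> c v \<subseteq> d u"
      unfolding c_def d_def using sub uv linked_trans[of u v "insert {u, v} S"] by blast
  qed
  have d1: "d w = d u" if "c w = c u \<or> c w = c v" for w
  proof -
    have "(w, u) \<in> linked (insert {u, v} S)"
      using that sub uv unfolding c_eq by (meson linked_sym linked_trans subsetD)
    then show ?thesis unfolding d_def by (simp add: linked_class_eq_iff)
  qed
  have d2: "d w = c w" if "c w \<noteq> c u" "c w \<noteq> c v" for w
  proof
    show "d w \<subseteq> c w"
    proof
      fix x assume "x \<in> d w"
      then have "(w, x) \<in> linked (insert {u, v} S)" by (simp add: d_def)
      from linked_insertD[OF this] that have "(w, x) \<in> linked S" by (auto simp: c_eq)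
      then show "x \<in> c w" by (simp add: c_def)
    qed
    show "c w \<subseteq> d w" unfolding c_def d_def using sub by blast
  qed
  have "d ` V = insert (c u \<union> c v) (c ` V - {c u, c v})"
  proof
    show "d ` V \<subseteq> insert (c u \<union> c v) (c ` V - {c u, c v})"
    proof
      fix Z assume "Z \<in> d ` V"
      then obtain w where w: "w \<in> V" "Z = d w" by auto
      show "Z \<in> insert (c u \<union> c v) (c ` V - {c u, c v})"
      proof (cases "c w = c u \<or> c w = c v")
        case True
        then show ?thesis using d1[of w] d_u w by simp
      next
        case False
        then show ?thesis using d2[of w] w by simp
      qed
    qed
    have "c ` V - {c u, c v} \<subseteq> d ` V"
    proof
      fix Z assume "Z \<in> c ` V - {c u, c v}"
      then obtain w where "w \<in> V" "Z = c w" "c w \<noteq> c u" "c w \<noteq> c v" by auto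
      then show "Z \<in> d ` V" using d2[of w] by (metis imageI)
    qed
    moreover have "c u \<union> c v \<in> d ` V" using d_u assms(2) by (metis imageI)
    ultimately show "insert (c u \<union> c v) (c ` V - {c u, c v}) \<subseteq> d ` V" by simp
  qed
  moreover have "c u \<union> c v \<notin> c ` V - {c u, c v}"
  proof
    assume "c u \<union> c v \<in> c ` V - {c u, c v}"
    then obtain w where w: "c u \<union> c v = c w" "c w \<noteq> c u" by auto
    have "u \<in> c u" by (simp add: c_def)
    then have "u \<in> c w" using w(1) by blast
    then have "c w = c u" unfolding c_eq by (simp add: c_def)
    then show False using w(2) by simp
  qed
  moreover have "card (c ` V - {c u, c v}) = card (c ` V) - 2"
    using assms by (subst card_Diff_subset) (auto simp: c_eq)
  moreover have "2 \<le> card (c ` V)"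
  proof -
    have "card {c u, c v} \<le> card (c ` V)" using assms by (intro card_mono) auto
    then show ?thesis using assms(4) by (simp add: c_eq)
  qed
  ultimately have "Suc (card (d ` V)) = card (c ` V)" using assms(1) by simp
  then show ?thesis by (simp add: comps_def c_def d_def)
qed

definition edges_on :: "'a set \<Rightarrow> 'a set set \<Rightarrow> bool" where
  "edges_on V S \<longleftrightarrow> (\<forall>e\<in>S. \<exists>u\<in>V. \<exists>v\<in>V. u \<noteq> v \<and> e = {u, v})"

lemma edges_onE:
  assumes "edges_on V S" "e \<in> S"
  obtains u v where "u \<in> V" "v \<in> V" "u \<noteq> v" "e = {u, v}"
  using assms by (auto simp: edges_on_def)

lemma edges_on_subset: "edges_on V S \<Longrightarrow> T \<subseteq> S \<Longrightarrow> edges_on V T"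
  by (auto simp: edges_on_def)

lemma comps_empty: "card (comps V {}) = card V"
proof -
  have "linked {} = (Id :: ('a \<times> 'a) set)" by (simp add: linked_def)
  then have "comps V {} = (\<lambda>v. {v}) ` V" by (auto simp: comps_def)
  then show ?thesis by (simp add: card_image)
qed

text \<open>Without edges there are \<open>card V\<close> singleton classes, and each edge of a
  forest, being a bridge, merges two classes when it is inserted.\<close>

lemma forest_card_comps:
  assumes "finite S" "finite V" "edges_on V S" "forest S"
  shows "card S + card (comps V S) = card V"
  using assms
proof (induction S rule: finite_induct)
  case empty
  then show ?case by (simp add: comps_empty)
next
  case (insert e S)
  obtain u v where uv: "u \<in> V" "v \<in> V" "e = {u, v}"
    using insert.prems(2) by (auto simp: edges_on_def)
  have "insert e S - {e} = S" using insert.hyps by auto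
  then have "(u, v) \<notin> linked S" using insert.prems(3) uv(3) by (auto simp: forest_def)
  from card_comps_insert[OF insert.prems(1) uv(1,2) this]
  have "card (comps V S) = Suc (card (comps V (insert e S)))" using uv(3) by simp
  moreover have "card S + card (comps V S) = card V"
    using insert.prems by (intro insert.IH) (auto simp: edges_on_def intro: forest_subset)
  ultimately show ?case using insert.hyps by simp
qed

text \<open>A minimal linking set plays the role of the path from \<open>u\<close> to
  \<open>v\<close>: that each of its edges is indispensable is all that the exchange arguments
  use.\<close>

lemma linked_minimal_path:
  assumes "finite S" "(u, v) \<in> linked S"
  obtains T where "T \<subseteq> S" "(u, v) \<in> linked T" "\<And>f. f \<in> T \<Longrightarrow> (u, v) \<notin> linked (T - {f})"
proof -
  obtain T where T: "T \<subseteq> S" "(u, v) \<in> linked T"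
    and min: "\<And>T'. T' \<subseteq> S \<Longrightarrow> (u, v) \<in> linked T' \<Longrightarrow> card T \<le> card T'"
    using ex_has_least_nat[of "\<lambda>T. T \<subseteq> S \<and> (u, v) \<in> linked T" S card] assms(2) by auto
  have "(u, v) \<notin> linked (T - {f})" if "f \<in> T" for f
  proof
    assume "(u, v) \<in> linked (T - {f})"
    then have "card T \<le> card (T - {f})" using T(1) by (intro min) auto
    moreover have "finite T" using T(1) assms(1) by (rule finite_subset)
    ultimately show False using that card_Diff1_less[of T f] by simp
  qed
  then show thesis using T that[of T] by simp
qed

text \<open>Paths in a forest are unique: a detour avoiding \<open>f\<close>, joined to the two
  pieces that \<open>f\<close> leaves of \<open>T\<close>, would link the ends of \<open>f\<close>
  in \<open>S - {f}\<close>.\<close>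

lemma forest_path_edge_is_bridge:
  assumes "forest S" "edges_on V S" "T \<subseteq> S" "(u, v) \<in> linked T"
    and f: "f \<in> T" "(u, v) \<notin> linked (T - {f})"
  shows "(u, v) \<notin> linked (S - {f})"
proof
  assume S: "(u, v) \<in> linked (S - {f})"
  obtain x y where xy: "f = {x, y}" using edges_onE[OF assms(2), of f] assms(3) f(1) by (metis subsetD)
  have "(u, v) \<in> linked (insert {x, y} (T - {f}))"
    using assms(4) f(1) xy by (simp add: insert_absorb)
  from linked_exchange[OF this f(2)] have "(x, y) \<in> linked (insert {u, v} (T - {f}))" .
  moreover have "linked (insert {u, v} (T - {f})) \<subseteq> linked (S - {f})"
  proof (rule linked_subset_linked)
    fix a b assume "{a, b} \<in> insert {u, v} (T - {f})"
    then have "a = u \<and> b = v \<or> a = v \<and> b = u \<or> {a, b} \<in> S - {f}"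
      using assms(3) by (auto simp: doubleton_eq_iff)
    then show "(a, b) \<in> linked (S - {f})" using S linked_sym linked_edge by metis
  qed
  ultimately have "(x, y) \<in> linked (S - {f})" by blast
  then show False using assms(1,3) f(1) xy by (auto simp: forest_def)
qed

text \<open>The edges \<open>uv\<close> and \<open>f\<close> lie on a common cycle, so the ends of
  either stay linked when the other one is kept.\<close>

lemma linked_swap:
  assumes "T \<subseteq> S" "(u, v) \<in> linked T" and f: "f \<in> T" "(u, v) \<notin> linked (T - {f})"
    and V: "edges_on V S"
  shows "linked (insert {u, v} (S - {f})) = linked S"
proof
  show "linked (insert {u, v} (S - {f})) \<subseteq> linked S"
  proof (rule linked_subset_linked)
    fix a b assume "{a, b} \<in> insert {u, v} (S - {f})"
    then have "a = u \<and> b = v \<or> a = v \<and> b = u \<or> {a, b} \<in> S"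
      by (auto simp: doubleton_eq_iff)
    moreover have "(u, v) \<in> linked S" using assms(1,2) linked_mono by blast
    ultimately show "(a, b) \<in> linked S" using linked_sym linked_edge by metis
  qed
  obtain x y where xy: "f = {x, y}" using edges_onE[OF V, of f] assms(1) f(1) by (metis subsetD)
  have "(u, v) \<in> linked (insert {x, y} (T - {f}))"
    using assms(2) f(1) xy by (simp add: insert_absorb)
  from linked_exchange[OF this f(2)] have "(x, y) \<in> linked (insert {u, v} (T - {f}))" .
  moreover have "linked (insert {u, v} (T - {f})) \<subseteq> linked (insert {u, v} (S - {f}))"
    using assms(1) by (intro linked_mono) auto
  ultimately have l: "(x, y) \<in> linked (insert {u, v} (S - {f}))" by blast
  show "linked S \<subseteq> linked (insert {u, v} (S - {f}))"
  proof (rule linked_subset_linked)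
    fix a b assume "{a, b} \<in> S"
    then have "a = x \<and> b = y \<or> a = y \<and> b = x \<or> {a, b} \<in> insert {u, v} (S - {f})"
      using xy by (auto simp: doubleton_eq_iff)
    then show "(a, b) \<in> linked (insert {u, v} (S - {f}))" using l linked_sym linked_edge by metis
  qed
qed

section \<open>Tree packing\<close>

definition packing :: "'a set set \<Rightarrow> nat \<Rightarrow> (nat \<Rightarrow> 'a set set) \<Rightarrow> bool" where
  "packing E K F \<longleftrightarrow> (\<forall>i<K. F i \<subseteq> E \<and> forest (F i)) \<and>
     (\<forall>i<K. \<forall>j<K. i \<noteq> j \<longrightarrow> F i \<inter> F j = {})"

lemma packing_disjoint: "packing E K F \<Longrightarrow> i < K \<Longrightarrow> j < K \<Longrightarrow> i \<noteq> j \<Longrightarrow> F i \<inter> F j = {}"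
  unfolding packing_def by blast

definition uncovered :: "'a set set \<Rightarrow> nat \<Rightarrow> (nat \<Rightarrow> 'a set set) \<Rightarrow> 'a set set" where
  "uncovered E K F = E - (\<Union>i<K. F i)"

text \<open>The last two conditions say that \<open>f\<close> lies on the path from \<open>u\<close>
  to \<open>v\<close> in \<open>F i\<close>, that is, on the cycle closed by the entering edge. The
  edge \<open>uv\<close> must be uncovered by the current packing \<open>F\<close>, not by the
  initial one.\<close>

inductive_set swaps :: "'a set set \<Rightarrow> nat \<Rightarrow> (nat \<Rightarrow> 'a set set) \<Rightarrow> (nat \<Rightarrow> 'a set set) set"
  for E K F0 where
  base: "F0 \<in> swaps E K F0"
| step: "F \<in> swaps E K F0 \<Longrightarrow> i < K \<Longrightarrow> {u, v} \<in> uncovered E K F \<Longrightarrow> f \<in> F i \<Longrightarrow>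
    (u, v) \<in> linked (F i) \<Longrightarrow> (u, v) \<notin> linked (F i - {f}) \<Longrightarrow>
    F(i := insert {u, v} (F i - {f})) \<in> swaps E K F0"

lemma packing_update:
  assumes "packing E K F" "i < K" "S \<subseteq> F i \<union> uncovered E K F" "forest S"
  shows "packing E K (F(i := S))"
  unfolding packing_def
proof (intro conjI allI impI)
  have S: "S \<subseteq> E" using assms(1-3) by (auto simp: packing_def uncovered_def)
  have disj: "S \<inter> F j = {}" if "j < K" "j \<noteq> i" for j
  proof -
    have "F i \<inter> F j = {}" using packing_disjoint[OF assms(1,2)] that by simp
    moreover have "uncovered E K F \<inter> F j = {}" using that by (auto simp: uncovered_def)
    ultimately show ?thesis using assms(3) by blast
  qed
  show "(F(i := S)) j \<subseteq> E" if "j < K" for j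
    using S assms(1) that by (simp add: packing_def)
  show "forest ((F(i := S)) j)" if "j < K" for j
    using assms(1,4) that by (simp add: packing_def)
  show "(F(i := S)) j \<inter> (F(i := S)) l = {}" if "j < K" "l < K" "j \<noteq> l" for j l
    using disj[of j] disj[of l] packing_disjoint[OF assms(1) that] that by (simp add: Int_commute)
qed

lemma swaps_packing:
  assumes "F \<in> swaps E K F0" "packing E K F0" "finite E"
  shows "packing E K F \<and> (\<forall>i. card (F i) = card (F0 i))"
  using assms(1)
proof induction
  case base
  then show ?case using assms by simp
next
  case (step F i u v f)
  have F: "packing E K F" using step.IH by simp
  then have Fi: "F i \<subseteq> E" "forest (F i)" using step.hyps by (auto simp: packing_def)
  have "forest (insert {u, v} (F i - {f}))"
    using Fi(2) step.hyps by (intro forest_insert) (auto intro: forest_subset)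
  then have "packing E K (F(i := insert {u, v} (F i - {f})))"
    using F step.hyps by (intro packing_update) auto
  moreover have "{u, v} \<notin> F i" using step.hyps by (auto simp: uncovered_def)
  moreover have "finite (F i)" using Fi(1) assms(3) by (rule finite_subset)
  moreover have "Suc (card (F i - {f})) = card (F i)"
    using \<open>finite (F i)\<close> step.hyps by (intro card_Suc_Diff1)
  ultimately have "card ((F(i := insert {u, v} (F i - {f}))) j) = card (F0 j)" for j
    using step.IH by simp
  then show ?case using \<open>packing E K (F(i := insert {u, v} (F i - {f})))\<close> by blast
qed

locale maximum_packing =
  fixes V :: "'a set" and E :: "'a set set" and K :: nat and F0 :: "nat \<Rightarrow> 'a set set"
  assumes finite_V: "finite V" and finite_E: "finite E" and edges_E: "edges_on V E"
    and packing_F0: "packing E K F0"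
    and maximum: "\<And>F. packing E K F \<Longrightarrow> (\<Sum>i<K. card (F i)) \<le> (\<Sum>i<K. card (F0 i))"
begin

text \<open>The edges freed by some sequence of swaps. Each swap exchanges an edge along a cycle inside
  this set, so it changes no connectivity class of any of the forests restricted to the set.\<close>

definition exchangeable :: "'a set set" where
  "exchangeable = (\<Union>F\<in>swaps E K F0. uncovered E K F)"

lemma exchangeable_subset: "exchangeable \<subseteq> E"
  by (auto simp: exchangeable_def uncovered_def)

lemma swaps_forest:
  assumes "F \<in> swaps E K F0" "i < K"
  shows "F i \<subseteq> E" "forest (F i)" "finite (F i)" "edges_on V (F i)"
proof -
  show "F i \<subseteq> E" "forest (F i)"
    using swaps_packing[OF assms(1) packing_F0 finite_E] assms(2) by (auto simp: packing_def)
  then show "finite (F i)" "edges_on V (F i)"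
    using finite_E edges_E by (auto intro: finite_subset edges_on_subset)
qed

text \<open>Swaps preserve the size of every forest, so \<open>F\<close> is again a maximum packing;
  an uncovered edge between two classes of \<open>F i\<close> could be added to it.\<close>

lemma uncovered_linked:
  assumes F: "F \<in> swaps E K F0" and i: "i < K" and e: "{u, v} \<in> uncovered E K F"
  shows "(u, v) \<in> linked (F i)"
proof (rule ccontr)
  assume "(u, v) \<notin> linked (F i)"
  note pF = swaps_packing[OF F packing_F0 finite_E]
  let ?F = "F(i := insert {u, v} (F i))"
  have new: "{u, v} \<notin> F i" using e i by (auto simp: uncovered_def)
  have "packing E K ?F"
    using pF i e \<open>(u, v) \<notin> linked (F i)\<close> swaps_forest[OF F i]
    by (intro packing_update forest_insert) auto
  then have le: "(\<Sum>j<K. card (?F j)) \<le> (\<Sum>j<K. card (F0 j))" by (rule maximum)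
  have "(\<Sum>j<K. card (F0 j)) = (\<Sum>j<K. card (F j))" using pF by simp
  also have "\<dots> < (\<Sum>j<K. card (?F j))"
    using i new swaps_forest[OF F i] by (intro sum_strict_mono_ex1) auto
  finally show False using le by simp
qed

text \<open>Each edge of the path that \<open>uv\<close> closes to a cycle can be swapped out for
  \<open>uv\<close>, and is uncovered afterwards.\<close>

lemma uncovered_path_in_exchangeable:
  assumes F: "F \<in> swaps E K F0" and i: "i < K" and e: "{u, v} \<in> uncovered E K F"
  obtains T where "T \<subseteq> F i \<inter> exchangeable" "(u, v) \<in> linked T"
proof -
  note Fi = swaps_forest[OF F i]
  note uv = uncovered_linked[OF assms]
  obtain T where T: "T \<subseteq> F i" "(u, v) \<in> linked T"
      "\<And>f. f \<in> T \<Longrightarrow> (u, v) \<notin> linked (T - {f})"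
    using linked_minimal_path[OF Fi(3) uv] by metis
  have "f \<in> exchangeable" if f: "f \<in> T" for f
  proof -
    have "(u, v) \<notin> linked (F i - {f})"
      by (rule forest_path_edge_is_bridge[OF Fi(2,4) T(1,2) f T(3)[OF f]])
    then have sw: "F(i := insert {u, v} (F i - {f})) \<in> swaps E K F0"
      using F i e uv f T(1) by (intro swaps.step) auto
    have fF: "f \<in> F i" "f \<in> E" using f T(1) Fi(1) by auto
    have "f \<notin> F j" if "j < K" "j \<noteq> i" for j
      using swaps_packing[OF F packing_F0 finite_E] packing_disjoint[of E K F i j] fF(1) i that
      by blast
    moreover have "f \<noteq> {u, v}" using e i fF by (auto simp: uncovered_def)
    ultimately have "f \<in> uncovered E K (F(i := insert {u, v} (F i - {f})))"
      using fF by (auto simp: uncovered_def)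
    then show "f \<in> exchangeable" using sw by (auto simp: exchangeable_def)
  qed
  then show thesis using T that[of T] by auto
qed

lemma linked_exchangeable_invariant:
  assumes "F \<in> swaps E K F0" "j < K"
  shows "linked (F j \<inter> exchangeable) = linked (F0 j \<inter> exchangeable)"
  using assms(1)
proof induction
  case base
  then show ?case by simp
next
  case (step F i u v f)
  show ?case
  proof (cases "j = i")
    case False
    then show ?thesis using step.IH by simp
  next
    case True
    obtain T where T: "T \<subseteq> F i \<inter> exchangeable" "(u, v) \<in> linked T"
      using uncovered_path_in_exchangeable[OF step.hyps(1-3)] by metis
    have nT: "(u, v) \<notin> linked (T - {f})"
      using step.hyps(6) linked_mono[of "T - {f}" "F i - {f}"] T(1) by blast
    \<comment> \<open>If \<open>f\<close> were outside \<open>T\<close>, removing it would not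
      change \<open>T\<close>, which still links \<open>u\<close> and \<open>v\<close>.\<close>
    then have fT: "f \<in> T" using T(2) by (metis Diff_empty Diff_insert0)
    have "{u, v} \<in> exchangeable" using step.hyps(1,3) by (auto simp: exchangeable_def)
    then have "insert {u, v} (F i - {f}) \<inter> exchangeable
        = insert {u, v} (F i \<inter> exchangeable - {f})" by auto
    also have "linked \<dots> = linked (F i \<inter> exchangeable)"
      using linked_swap[OF T fT nT] edges_on_subset[OF swaps_forest(4)[OF step.hyps(1,2)]] by blast
    finally show ?thesis using step.IH True by simp
  qed
qed

text \<open>Each exchangeable edge is uncovered in some reachable packing, where a path in forest
  \<open>i\<close> inside \<open>exchangeable\<close> bypasses it; by the invariance this link is
  already present in \<open>F0 i\<close>. Thus every initial forest spans each class of
  \<open>exchangeable\<close>.\<close>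

lemma linked_exchangeable:
  assumes "i < K"
  shows "linked (F0 i \<inter> exchangeable) = linked exchangeable"
proof
  show "linked (F0 i \<inter> exchangeable) \<subseteq> linked exchangeable" by (rule linked_mono) auto
  show "linked exchangeable \<subseteq> linked (F0 i \<inter> exchangeable)"
  proof (rule linked_subset_linked)
    fix u v assume "{u, v} \<in> exchangeable"
    then obtain F where F: "F \<in> swaps E K F0" "{u, v} \<in> uncovered E K F"
      by (auto simp: exchangeable_def)
    obtain T where "T \<subseteq> F i \<inter> exchangeable" "(u, v) \<in> linked T"
      using uncovered_path_in_exchangeable[OF F(1) assms F(2)] by metis
    then have "(u, v) \<in> linked (F i \<inter> exchangeable)" using linked_mono by blast
    then show "(u, v) \<in> linked (F0 i \<inter> exchangeable)"
      using linked_exchangeable_invariant[OF F(1) assms] by simp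
  qed
qed

text \<open>Inside \<open>exchangeable\<close> each forest has \<open>card V\<close> minus the
  number of classes many edges. Outside, every edge of \<open>E\<close> is covered, by exactly one
  forest.\<close>

lemma sum_card_packing:
  "(\<Sum>i<K. card (F0 i)) + K * card (comps V exchangeable) = K * card V + card (E - exchangeable)"
proof -
  have F0: "F0 i \<subseteq> E" "forest (F0 i)" "finite (F0 i)" "edges_on V (F0 i)" if "i < K" for i
    using swaps_forest[OF swaps.base that] by auto
  have disj: "F0 i \<inter> F0 j = {}" if "i < K" "j < K" "i \<noteq> j" for i j
    using packing_F0 that by (auto simp: packing_def)
  have card_in: "card (F0 i \<inter> exchangeable) + card (comps V exchangeable) = card V" if "i < K" for i
  proof -
    have "card (F0 i \<inter> exchangeable) + card (comps V (F0 i \<inter> exchangeable)) = card V"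
      using F0[OF that] finite_V
      by (intro forest_card_comps) (auto intro: forest_subset edges_on_subset)
    then show ?thesis by (simp add: comps_def linked_exchangeable[OF that])
  qed
  have "E - exchangeable = (\<Union>i<K. F0 i - exchangeable)"
  proof
    show "E - exchangeable \<subseteq> (\<Union>i<K. F0 i - exchangeable)"
      using swaps.base[of F0 E K] by (auto simp: exchangeable_def uncovered_def)
    show "(\<Union>i<K. F0 i - exchangeable) \<subseteq> E - exchangeable" using F0(1) by auto
  qed
  also have "card \<dots> = (\<Sum>i<K. card (F0 i - exchangeable))"
    using F0(3) disj by (intro card_UN_disjoint) auto
  finally have out: "card (E - exchangeable) = (\<Sum>i<K. card (F0 i - exchangeable))" .
  have "card (F0 i) = card (F0 i \<inter> exchangeable) + card (F0 i - exchangeable)" if "i < K" for i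
    using card_Int_Diff[of "F0 i" exchangeable] F0(3)[OF that] by simp
  then have "(\<Sum>i<K. card (F0 i)) = (\<Sum>i<K. card (F0 i \<inter> exchangeable)) + card (E - exchangeable)"
    by (simp add: out sum.distrib)
  moreover have "(\<Sum>i<K. card (F0 i \<inter> exchangeable)) + K * card (comps V exchangeable)
      = (\<Sum>i<K. card (F0 i \<inter> exchangeable) + card (comps V exchangeable))"
    by (simp add: sum.distrib)
  moreover have "\<dots> = K * card V" using card_in by simp
  ultimately show ?thesis by simp
qed

end

lemma partition_on_comps:
  assumes "edges_on V S"
  shows "partition_on V (comps V S)"
proof (rule partition_onI)
  have inV: "y \<in> V" if "x \<in> V" "(x, y) \<in> linked S" for x y
    using that(2,1) unfolding linked_def
  proof (induction rule: rtrancl_induct)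
    case (step y z)
    then have "{y, z} \<in> S" by simp
    then show ?case using edges_onE[OF assms] by (metis doubleton_eq_iff)
  qed
  have self: "x \<in> linked S `` {x}" for x by simp
  show "\<Union> (comps V S) = V" unfolding comps_def using inV self by blast
  show "{} \<notin> comps V S"
  proof
    assume "{} \<in> comps V S"
    then obtain x where "{} = linked S `` {x}" unfolding comps_def by (elim imageE)
    then show False using self[of x] by simp
  qed
  fix P Q assume "P \<in> comps V S" "Q \<in> comps V S" "P \<noteq> Q"
  then obtain x y where xy: "P = linked S `` {x}" "Q = linked S `` {y}" and "P \<noteq> Q"
    unfolding comps_def by blast
  then have nxy: "(x, y) \<notin> linked S" by (simp add: linked_class_eq_iff)
  have "\<not> ((x, z) \<in> linked S \<and> (y, z) \<in> linked S)" for z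
    using nxy linked_sym[of y z S] linked_trans[of x z S y] by blast
  then show "disjnt P Q" unfolding xy disjnt_iff by blast
qed

text \<open>The classes of \<open>exchangeable\<close> are the critical partition: only edges
  outside \<open>exchangeable\<close> can cross it. The cut hypothesis for it raises the count of
  \<open>sum_card_packing\<close> to at least K (|V| - 1) edges, which leaves each of the
  \<open>K\<close> forests a single class.\<close>

theorem tree_packing:
  assumes "finite V" "V \<noteq> {}" "edges_on V E"
    and cuts: "\<And>P. partition_on V P \<Longrightarrow> K * (card P - 1) \<le> card {e \<in> E. \<not> (\<exists>U\<in>P. e \<subseteq> U)}"
  obtains F where "packing E K F" "\<And>i u v. i < K \<Longrightarrow> u \<in> V \<Longrightarrow> v \<in> V \<Longrightarrow> (u, v) \<in> linked (F i)"
proof -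
  have "E \<subseteq> Pow V" using assms(3) by (auto elim: edges_onE)
  then have finE: "finite E" using assms(1) by (simp add: finite_subset)
  have "packing E K (\<lambda>_. {})" by (simp add: packing_def forest_def)
  moreover have "(\<Sum>i<K. card (F i)) < Suc (K * card E)" if "packing E K F" for F
  proof -
    have "card (F i) \<le> card E" if "i < K" for i
      using \<open>packing E K F\<close> that finE by (auto simp: packing_def intro: card_mono)
    then have "(\<Sum>i<K. card (F i)) \<le> (\<Sum>i<K. card E)" by (intro sum_mono) auto
    then show ?thesis by simp
  qed
  ultimately obtain F0 where F0: "packing E K F0"
      "\<And>F. packing E K F \<Longrightarrow> (\<Sum>i<K. card (F i)) \<le> (\<Sum>i<K. card (F0 i))"
    using ex_has_greatest_nat[of "packing E K" "\<lambda>_. {}" "\<lambda>F. \<Sum>i<K. card (F i)" "Suc (K * card E)"]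
    by (metis less_imp_le)
  interpret maximum_packing V E K F0
    using assms(1,3) finE F0 by unfold_locales
  have exV: "edges_on V exchangeable" using assms(3) exchangeable_subset by (rule edges_on_subset)
  have "{e \<in> E. \<not> (\<exists>U\<in>comps V exchangeable. e \<subseteq> U)} \<subseteq> E - exchangeable"
  proof -
    have "\<exists>U\<in>comps V exchangeable. e \<subseteq> U" if "e \<in> exchangeable" for e
    proof -
      obtain u v where uv: "u \<in> V" "e = {u, v}" using edges_onE[OF exV \<open>e \<in> exchangeable\<close>] by metis
      then have "e \<subseteq> linked exchangeable `` {u}" using that by (auto intro: linked_edge)
      then show ?thesis using uv unfolding comps_def by blast
    qed
    then show ?thesis by auto
  qed
  then have "K * (card (comps V exchangeable) - 1) \<le> card (E - exchangeable)"
    using cuts[OF partition_on_comps[OF exV]] finE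
    by (meson card_mono finite_Diff le_trans)
  moreover have "1 \<le> card (comps V exchangeable)"
    using assms(1,2) by (simp add: comps_def Suc_le_eq card_gt_0_iff)
  ultimately have "K * card (comps V exchangeable) \<le> card (E - exchangeable) + K"
    by (simp add: diff_mult_distrib2)
  then have tot: "K * card V \<le> (\<Sum>i<K. card (F0 i)) + K"
    using sum_card_packing by linarith
  have F0i: "card (F0 i) + card (comps V (F0 i)) = card V" if "i < K" for i
    using swaps_forest[OF swaps.base that] finite_V by (intro forest_card_comps)
  have "(\<Sum>i<K. card (F0 i)) + (\<Sum>i<K. card (comps V (F0 i))) = (\<Sum>i<K. card V)"
    unfolding sum.distrib[symmetric] using F0i by (intro sum.cong) auto
  then have le: "(\<Sum>i<K. card (comps V (F0 i))) \<le> (\<Sum>i<K. 1)" using tot by simp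
  have ge: "1 \<le> card (comps V (F0 i))" for i
    using assms(1,2) by (simp add: comps_def Suc_le_eq card_gt_0_iff)
  have one: "card (comps V (F0 i)) = 1" if "i < K" for i
  proof (rule ccontr)
    assume "card (comps V (F0 i)) \<noteq> 1"
    then have "1 < card (comps V (F0 i))" using ge[of i] by simp
    then have "(\<Sum>i<K. 1) < (\<Sum>i<K. card (comps V (F0 i)))"
      using ge that by (intro sum_strict_mono_ex1) auto
    then show False using le by simp
  qed
  have "(u, v) \<in> linked (F0 i)" if "i < K" "u \<in> V" "v \<in> V" for i u v
  proof -
    obtain C where "comps V (F0 i) = {C}" using one[OF \<open>i < K\<close>] by (metis card_1_singletonE)
    then have "linked (F0 i) `` {u} = linked (F0 i) `` {v}"
      using \<open>u \<in> V\<close> \<open>v \<in> V\<close> by (metis comps_def image_eqI singletonD)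
    then show ?thesis by (simp add: linked_class_eq_iff)
  qed
  then show thesis using F0(1) that[of F0] by simp
qed

section \<open>From edge sets to acyclic graphs, paths and spanning trees\<close>

lemma forest_acyclic_graph:
  assumes "forest (edges T)"
  shows "acyclic_graph T"
  unfolding acyclic_graph_def is_cycle_def
proof (rule notI, elim exE conjE)
  fix p assume len: "3 \<le> length p" and path: "path_between T (hd p) p (last p)"
    and e: "{last p, hd p} \<in> edges T"
  have ne: "p \<noteq> []" using len by auto
  have dist: "distinct p" using path by (simp add: path_between_def)
  have "(hd p, p ! i) \<in> linked (edges T - {{last p, hd p}})" if "i < length p" for i
    using that
  proof (induction i)
    case 0
    then show ?case using ne by (simp add: hd_conv_nth)
  next
    case (Suc i)
    have "{p ! i, p ! Suc i} \<in> edges T" using path Suc.prems by (simp add: path_between_def)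
    \<comment> \<open>A step of the path is never the closing edge: by distinctness that would need
      \<open>i = 0\<close> and \<open>Suc i\<close> the last index, hence a list of length
      2.\<close>
    moreover have "{p ! i, p ! Suc i} \<noteq> {p ! (length p - 1), p ! 0}"
    proof
      assume "{p ! i, p ! Suc i} = {p ! (length p - 1), p ! 0}"
      then consider "p ! i = p ! (length p - 1)" | "p ! i = p ! 0" "p ! Suc i = p ! (length p - 1)"
        unfolding doubleton_eq_iff by blast
      then show False
      proof cases
        case 1
        then have "i = length p - 1"
          using nth_eq_iff_index_eq[OF dist, of i "length p - 1"] len Suc.prems by simp
        then show False using Suc.prems by simp
      next
        case 2
        then have "i = 0" "Suc i = length p - 1"
          using nth_eq_iff_index_eq[OF dist, of i 0]
            nth_eq_iff_index_eq[OF dist, of "Suc i" "length p - 1"] ne len Suc.prems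
          by simp_all
        then show False using len by simp
      qed
    qed
    ultimately have "(p ! i, p ! Suc i) \<in> linked (edges T - {{last p, hd p}})"
      using ne by (intro linked_edge) (simp add: hd_conv_nth last_conv_nth)
    then show ?case using Suc linked_trans by (metis Suc_lessD)
  qed
  from this[of "length p - 1"] have "(hd p, last p) \<in> linked (edges T - {{last p, hd p}})"
    using ne by (simp add: last_conv_nth)
  then show False using assms e unfolding forest_def by (metis linked_sym)
qed

lemma linked_imp_path_between:
  assumes "(u, v) \<in> linked (edges T)" "u \<in> verts T" "edges_on (verts T) (edges T)"
  shows "\<exists>p. path_between T u p v"
  using assms(1)[unfolded linked_def]
proof (induction rule: rtrancl_induct)
  case base
  have "path_between T u [u] u" using assms(2) by (simp add: path_between_def)
  then show ?case by blast
next
  case (step y z)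
  then obtain p where p: "path_between T u p y" by blast
  have yz: "{y, z} \<in> edges T" using step.hyps by simp
  then have "z \<in> verts T" using edges_onE[OF assms(3) yz] by (metis doubleton_eq_iff)
  show ?case
  proof (cases "z \<in> set p")
    case True
    then obtain j where j: "j < length p" "p ! j = z" by (auto simp: in_set_conv_nth)
    \<comment> \<open>Appending a vertex that was already visited would break distinctness, so the
      path is cut off at that vertex instead.\<close>
    have "path_between T u (take (Suc j) p) z"
      using p j unfolding path_between_def
      by (auto simp: hd_conv_nth last_conv_nth dest: in_set_takeD)
    then show ?thesis by blast
  next
    case False
    have ne: "p \<noteq> []" and "last p = y" using p by (auto simp: path_between_def)
    then have last: "p ! (length p - 1) = y" by (simp add: last_conv_nth)
    have "{(p @ [z]) ! i, (p @ [z]) ! Suc i} \<in> edges T" if "Suc i < length (p @ [z])" for i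
    proof (cases "Suc i < length p")
      case True
      then show ?thesis using p by (simp add: nth_append path_between_def)
    next
      case False
      then have "i = length p - 1" "Suc i = length p" using that by auto
      then show ?thesis using last yz ne by (simp add: nth_append)
    qed
    then have "path_between T u (p @ [z]) z"
      using p False \<open>z \<in> verts T\<close> ne unfolding path_between_def by simp
    then show ?thesis by blast
  qed
qed

lemma spanning_tree_of_forest:
  assumes G: "simple_graph G" "verts G \<noteq> {}" and F: "F \<subseteq> edges G" "forest F"
    and edges: "edges_on (verts G) (edges G)"
    and linked: "\<And>u v. u \<in> verts G \<Longrightarrow> v \<in> verts G \<Longrightarrow> (u, v) \<in> linked F"
  shows "spanning_tree_of \<lparr>verts = verts G, edges = F\<rparr> G"
proof -
  have "edges_on (verts G) F" using edges F(1) by (rule edges_on_subset)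
  then have "connected_graph \<lparr>verts = verts G, edges = F\<rparr>"
    using G(2) linked by (auto simp: connected_graph_def intro!: linked_imp_path_between)
  then show ?thesis
    using G F unfolding spanning_tree_of_def subgraph_of_def simple_graph_def
    by (auto intro: forest_acyclic_graph)
qed

lemma simple_graph_edges_on:
  assumes "simple_graph G"
  shows "edges_on (verts G) (edges G)"
  unfolding edges_on_def
proof
  fix e assume e: "e \<in> edges G"
  then have "card e = 2" "e \<subseteq> verts G" using assms by (auto simp: simple_graph_def)
  then show "\<exists>u\<in>verts G. \<exists>v\<in>verts G. u \<noteq> v \<and> e = {u, v}" by (auto simp: card_2_iff)
qed

section \<open>Partitions of dense bipartite graphs\<close>

lemma sum_card_partition_on:
  assumes "finite V" "partition_on V P"
  shows "(\<Sum>U\<in>P. card U) = card V"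
proof -
  have "card (\<Union>P) = (\<Sum>U\<in>P. card U)"
    using assms by (intro card_Union_disjoint)
      (auto simp: partition_on_def disjoint_def pairwise_def disjnt_def intro: finite_subset)
  then show ?thesis using assms(2) by (simp add: partition_on_def)
qed

lemma card_part_le:
  assumes "finite V" "partition_on V P" "U \<in> P"
  shows "card U + (card P - 1) \<le> card V"
proof -
  have fin: "finite P" using assms by (intro finite_elements)
  have pos: "1 \<le> card W" if "W \<in> P" for W
    using assms that by (metis One_nat_def Suc_leI card_gt_0_iff finite_UnionD finite_subset
        partition_onD1 partition_onD3 Union_upper)
  have "(\<Sum>W\<in>P - {U}. 1) \<le> (\<Sum>W\<in>P - {U}. card W)" using pos by (intro sum_mono) auto
  then have "card P - 1 \<le> (\<Sum>W\<in>P - {U}. card W)" using assms(3) by simp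
  moreover have "(\<Sum>W\<in>P. card W) = card U + (\<Sum>W\<in>P - {U}. card W)"
    using fin assms(3) by (rule sum.remove)
  ultimately show ?thesis using sum_card_partition_on[OF assms(1,2)] by simp
qed

text \<open>The chord of the square function over the interval from 1 to \<open>L\<close> bounds each term.\<close>

lemma sum_square_card_partition_on:
  assumes "finite V" "partition_on V P" and L: "\<And>U. U \<in> P \<Longrightarrow> card U \<le> L"
  shows "(\<Sum>U\<in>P. (int (card U))\<^sup>2) \<le> (int L + 1) * int (card V) - int L * int (card P)"
proof -
  have fin: "finite P" using assms by (intro finite_elements)
  have "(int (card U))\<^sup>2 \<le> (int L + 1) * int (card U) - int L" if U: "U \<in> P" for U
  proof -
    have "U \<noteq> {}" "finite U"
      using assms(1,2) U by (auto simp: partition_on_def intro: finite_subset)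
    then have "1 \<le> int (card U)" by (simp add: Suc_le_eq card_gt_0_iff)
    then have "0 \<le> (int (card U) - 1) * (int L - int (card U))" using L[OF U] by simp
    then show ?thesis by (simp add: algebra_simps power2_eq_square)
  qed
  then have "(\<Sum>U\<in>P. (int (card U))\<^sup>2) \<le> (\<Sum>U\<in>P. (int L + 1) * int (card U) - int L)"
    by (intro sum_mono)
  also have "\<dots> = (int L + 1) * int (\<Sum>U\<in>P. card U) - int L * int (card P)"
    by (simp add: sum_subtractf sum_distrib_left)
  finally show ?thesis using sum_card_partition_on[OF assms(1,2)] by simp
qed

definition cross_edges :: "'a set set \<Rightarrow> 'a set set \<Rightarrow> 'a set set" where
  "cross_edges E P = {e \<in> E. \<not> (\<exists>U\<in>P. e \<subseteq> U)}"

text \<open>A vertex outside \<open>U\<close> has at most |V - U| - 1 neighbours outside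
  \<open>U\<close>, so the rest of its edges end in \<open>U\<close>. These edges all cross and are
  distinct for distinct vertices. With truncated subtraction the bound is informative only when
  \<open>U\<close> is almost everything.\<close>

lemma card_cross_edges_ge_degrees:
  assumes "finite V" "edges_on V E" "partition_on V P" "U \<in> P"
    and deg: "\<And>v. v \<in> V \<Longrightarrow> d \<le> card {e \<in> E. v \<in> e}"
  shows "card (V - U) * (d + 1 - card (V - U)) \<le> card (cross_edges E P)"
proof -
  define X where "X = V - U"
  define N where "N v = {e \<in> E. v \<in> e} - (\<lambda>w. {v, w}) ` (X - {v})" for v
  have finE: "finite E"
  proof -
    have "E \<subseteq> Pow V" using assms(2) by (auto elim: edges_onE)
    then show ?thesis using assms(1) by (simp add: finite_subset)
  qed
  have finX: "finite X" using assms(1) by (simp add: X_def)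
  have N_mem: "\<exists>w\<in>U. e = {v, w}" if v: "v \<in> X" and e: "e \<in> N v" for v e
  proof -
    have eE: "e \<in> E" "v \<in> e" using e by (auto simp: N_def)
    obtain a b where ab: "a \<in> V" "b \<in> V" "a \<noteq> b" "e = {a, b}" using edges_onE[OF assms(2) eE(1)] .
    then obtain w where w: "w \<in> V" "w \<noteq> v" "e = {v, w}" using eE(2) by fastforce
    then have "w \<notin> X" using e by (auto simp: N_def)
    then show ?thesis using w by (auto simp: X_def)
  qed
  have N_card: "d + 1 - card X \<le> card (N v)" if v: "v \<in> X" for v
  proof -
    have "card ((\<lambda>w. {v, w}) ` (X - {v})) \<le> card (X - {v})"
      using finX by (intro card_image_le) simp
    also have "\<dots> = card X - 1" using v by simp
    finally have "card ((\<lambda>w. {v, w}) ` (X - {v})) \<le> card X - 1" .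
    moreover have "d \<le> card {e \<in> E. v \<in> e}" using v deg by (simp add: X_def)
    moreover have "card {e \<in> E. v \<in> e} - card ((\<lambda>w. {v, w}) ` (X - {v})) \<le> card (N v)"
      unfolding N_def using finX by (intro diff_card_le_card_Diff) simp
    moreover have "card X \<ge> 1" using v finX by (metis One_nat_def Suc_leI card_gt_0_iff empty_iff)
    ultimately show ?thesis by linarith
  qed
  have N_cross: "N v \<subseteq> cross_edges E P" if v: "v \<in> X" for v
  proof
    fix e assume e: "e \<in> N v"
    obtain w where w: "w \<in> U" "e = {v, w}" using N_mem[OF v e] by blast
    have "\<not> e \<subseteq> W" if W: "W \<in> P" for W
    proof
      assume "e \<subseteq> W"
      then have "w \<in> W \<inter> U" "v \<in> W" using w by auto
      then have "W = U" using assms(3,4) W by (auto simp: partition_on_def disjoint_def)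
      then show False using \<open>v \<in> W\<close> v by (simp add: X_def)
    qed
    then show "e \<in> cross_edges E P" using e by (auto simp: cross_edges_def N_def)
  qed
  have N_disj: "N v \<inter> N w = {}" if "v \<in> X" "w \<in> X" "v \<noteq> w" for v w
  proof (rule ccontr)
    assume "N v \<inter> N w \<noteq> {}"
    then obtain e where e: "e \<in> N v" "e \<in> N w" by auto
    obtain a b where ab: "a \<in> U" "b \<in> U" "e = {v, a}" "e = {w, b}"
      using N_mem[OF \<open>v \<in> X\<close> e(1)] N_mem[OF \<open>w \<in> X\<close> e(2)] by blast
    then show False using that by (auto simp: doubleton_eq_iff X_def)
  qed
  have "card X * (d + 1 - card X) \<le> (\<Sum>v\<in>X. card (N v))"
    using sum_bounded_below[of X "d + 1 - card X" "\<lambda>v. card (N v)"] N_card by simp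
  also have "\<dots> = card (\<Union>v\<in>X. N v)"
    using finX finE N_disj by (intro card_UN_disjoint[symmetric]) (auto simp: N_def)
  also have "\<dots> \<le> card (cross_edges E P)"
    using N_cross finE by (intro card_mono) (auto simp: cross_edges_def)
  finally show ?thesis by (simp add: X_def)
qed

text \<open>A part \<open>U\<close> contains at most |U \<inter> A| |U \<inter> B| edges, which is
  at most |U|^2 / 4 by the inequality of arithmetic and geometric means.\<close>

lemma card_cross_edges_bipartite:
  assumes "finite A" "finite B" "A \<inter> B = {}" and P: "partition_on (A \<union> B) P"
    and E: "\<And>e. e \<in> E \<Longrightarrow> \<exists>a\<in>A. \<exists>b\<in>B. e = {a, b}"
  shows "4 * int (card E) \<le> 4 * int (card (cross_edges E P)) + (\<Sum>U\<in>P. (int (card U))\<^sup>2)"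
proof -
  define I where "I = {e \<in> E. \<exists>U\<in>P. e \<subseteq> U}"
  have "E \<subseteq> Pow (A \<union> B)" using E by fastforce
  then have finE: "finite E" using assms(1,2) by (simp add: finite_subset)
  have finP: "finite P" using finite_elements[OF _ P] assms(1,2) by simp
  have finU: "finite U" if "U \<in> P" for U
    using P that assms(1,2) by (auto simp: partition_on_def intro: finite_subset[of U "A \<union> B"])
  have "I \<subseteq> (\<Union>U\<in>P. (\<lambda>(a, b). {a, b}) ` ((U \<inter> A) \<times> (U \<inter> B)))"
  proof
    fix e assume "e \<in> I"
    then obtain U where U: "e \<in> E" "U \<in> P" "e \<subseteq> U" by (auto simp: I_def)
    then obtain a b where "a \<in> A" "b \<in> B" "e = {a, b}" using E by blast
    then show "e \<in> (\<Union>U\<in>P. (\<lambda>(a, b). {a, b}) ` ((U \<inter> A) \<times> (U \<inter> B)))"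
      using U by (intro UN_I[of U] image_eqI[of _ _ "(a, b)"]) auto
  qed
  then have "card I \<le> card (\<Union>U\<in>P. (\<lambda>(a, b). {a, b}) ` ((U \<inter> A) \<times> (U \<inter> B)))"
    using finP assms(1,2) by (intro card_mono) auto
  also have "\<dots> \<le> (\<Sum>U\<in>P. card ((\<lambda>(a, b). {a, b}) ` ((U \<inter> A) \<times> (U \<inter> B))))"
    using finP by (rule card_UN_le)
  also have "\<dots> \<le> (\<Sum>U\<in>P. card (U \<inter> A) * card (U \<inter> B))"
    unfolding card_cartesian_product[symmetric]
    using assms(1,2) by (intro sum_mono card_image_le) auto
  finally have "4 * int (card I) \<le> (\<Sum>U\<in>P. 4 * (int (card (U \<inter> A)) * int (card (U \<inter> B))))"
    by (simp flip: sum_distrib_left of_nat_mult of_nat_sum)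
  also have "\<dots> \<le> (\<Sum>U\<in>P. (int (card U))\<^sup>2)"
  proof (rule sum_mono)
    fix U assume U: "U \<in> P"
    then have "U = (U \<inter> A) \<union> (U \<inter> B)" using P by (auto simp: partition_on_def)
    then have "card U = card (U \<inter> A) + card (U \<inter> B)"
      using assms(3) finU[OF U] by (metis card_Un_disjoint finite_Un Int_assoc Int_empty_right
          Int_left_commute inf_left_idem)
    moreover have "0 \<le> (int (card (U \<inter> A)) - int (card (U \<inter> B)))\<^sup>2" by simp
    ultimately show "4 * (int (card (U \<inter> A)) * int (card (U \<inter> B))) \<le> (int (card U))\<^sup>2"
      by (simp add: power2_eq_square algebra_simps)
  qed
  moreover have "card E = card I + card (cross_edges E P)"
  proof -
    have "E = I \<union> cross_edges E P" "I \<inter> cross_edges E P = {}"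
      by (auto simp: I_def cross_edges_def)
    then show ?thesis using finE by (metis card_Un_disjoint finite_Un)
  qed
  ultimately show ?thesis by simp
qed

text \<open>At most 3m/2 edges of the complete bipartite graph are missing. If no part is too large,
  convexity bounds the edges inside parts and this density suffices; a part omitting at most three
  vertices is left to the degree bound.\<close>

lemma dense_bipartite_cuts:
  assumes "finite A" "finite B" "A \<inter> B = {}" "card A = m" "card B = m"
    and E: "\<And>e. e \<in> E \<Longrightarrow> \<exists>a\<in>A. \<exists>b\<in>B. e = {a, b}"
    and dense: "2 * m ^ 2 \<le> 2 * card E + 3 * m"
    and deg: "\<And>v. v \<in> A \<union> B \<Longrightarrow> K + 1 \<le> card {e \<in> E. v \<in> e}"
    and K: "2 \<le> K" "2 * K + 2 \<le> m"
    and P: "partition_on (A \<union> B) P"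
  shows "K * (card P - 1) \<le> card (cross_edges E P)"
proof -
  define t where "t = card P - 1"
  define c where "c = card (cross_edges E P)"
  have V: "finite (A \<union> B)" "card (A \<union> B) = 2 * m"
    using assms by (auto simp: card_Un_disjoint)
  have "edges_on (A \<union> B) E"
    unfolding edges_on_def
  proof
    fix e assume "e \<in> E"
    then obtain a b where "a \<in> A" "b \<in> B" "e = {a, b}" using E by blast
    then show "\<exists>u\<in>A \<union> B. \<exists>v\<in>A \<union> B. u \<noteq> v \<and> e = {u, v}"
      using assms(3) by (intro bexI[of _ a] bexI[of _ b]) auto
  qed
  note degrees = card_cross_edges_ge_degrees[OF V(1) this P _ deg]
  have part_le: "card U + t \<le> 2 * m" if "U \<in> P" for U
    using card_part_le[OF V(1) P that] V(2) by (simp add: t_def)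
  have P_ne: "P \<noteq> {}" using P V(2) K by (auto simp: partition_on_def)
  then have cardP: "card P = t + 1"
    using finite_elements[OF V(1) P] by (simp add: t_def card_gt_0_iff)
  have "4 * int (card E) \<le> 4 * int c + (\<Sum>U\<in>P. (int (card U))\<^sup>2)"
    unfolding c_def using assms(1-3) P E by (rule card_cross_edges_bipartite)
  then have size: "4 * int (card E) \<le> 4 * int c + ((int L + 1) * (2 * int m) - int L * (int t + 1))"
    if "\<And>U. U \<in> P \<Longrightarrow> card U \<le> L" for L
    using sum_square_card_partition_on[OF V(1) P that] V(2) cardP by (simp add: add.commute)
  have dense': "4 * (int m)\<^sup>2 \<le> 4 * int (card E) + 6 * int m"
  proof -
    have "int (2 * m ^ 2) \<le> int (2 * card E + 3 * m)" using dense by (simp only: of_nat_le_iff)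
    then show ?thesis by simp
  qed
  have small: "card (A \<union> B - U) * (K + 2 - card (A \<union> B - U)) \<le> c"
    "card (A \<union> B - U) + card U = 2 * m" if "U \<in> P" for U
  proof -
    show "card (A \<union> B - U) * (K + 2 - card (A \<union> B - U)) \<le> c"
      using degrees[OF that] by (simp add: c_def)
    have "U \<subseteq> A \<union> B" using P that by (auto simp: partition_on_def)
    then show "card (A \<union> B - U) + card U = 2 * m"
      using V by (metis add.commute card_Diff_subset card_mono finite_subset le_add_diff_inverse)
  qed
  have "K * t \<le> c"
  proof (cases "t \<ge> 3")
    case True
    obtain U where "U \<in> P" using P_ne by auto
    then have t: "t \<le> 2 * m" using part_le by fastforce
    have "card U \<le> 2 * m - t" if "U \<in> P" for U using part_le[OF that] by simp
    from size[OF this] have *: "4 * int (card E) \<le> 4 * int c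
        + ((2 * int m - int t + 1) * (2 * int m) - (2 * int m - int t) * (int t + 1))"
      using t by (simp add: of_nat_diff)
    \<comment> \<open>Taking L = 2m - t, the largest possible part size, the density estimate yields
      4c - (2m - 4) t >= (t - 3)(2m - t). Hence the split at t = 3; then m >= 2K + 2 turns 2m - 4
      into at least 4K.\<close>
    have "0 \<le> (int t - 3) * (2 * int m - int t)" using True t by simp
    then have **: "(2 * int m - 4) * int t \<le> 4 * int c"
      using * dense' by (simp add: algebra_simps power2_eq_square)
    have "4 * int K * int t \<le> (2 * int m - 4) * int t"
      using K by (intro mult_right_mono) auto
    then have "4 * (int K * int t) \<le> 4 * int c" using ** by linarith
    then show ?thesis by (simp flip: of_nat_mult)
  next
    case False
    then consider "t = 0" | "t = 1" | "t = 2" by linarith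
    then show ?thesis
    proof cases
      case 1
      then show ?thesis by simp
    next
      case 2
      show ?thesis
      \<comment> \<open>Up to this size density gives c >= m - 2 >= 2K. A larger part omits s = 1, 2
        or 3 vertices, and s (K + 2 - s) >= K since K >= 2.\<close>
      proof (cases "\<forall>U\<in>P. card U \<le> 2 * m - 4")
        case True
        then have "4 * int (card E) \<le> 4 * int c + ((2 * int m - 3) * (2 * int m) - (2 * int m - 4) * 2)"
          using size[of "2 * m - 4"] K 2 by (simp add: of_nat_diff)
        then have "4 * int m - 8 \<le> 4 * int c"
          using dense' by (simp add: algebra_simps power2_eq_square)
        then show ?thesis using K 2 by simp
      next
        case False
        then obtain U where U: "U \<in> P" "card U > 2 * m - 4" by auto
        have "card (A \<union> B - U) \<le> 3" "card (A \<union> B - U) \<ge> 1"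
          using small(2)[OF U(1)] part_le[OF U(1)] U(2) 2 by linarith+
        then consider "card (A \<union> B - U) = 1" | "card (A \<union> B - U) = 2" | "card (A \<union> B - U) = 3"
          by linarith
        then show ?thesis using small(1)[OF U(1)] K 2 by cases auto
      qed
    next
      case 3
      show ?thesis
      \<comment> \<open>Density gives 4c >= 4m - 9 >= 8K - 1, hence c >= 2K by integrality.
        Otherwise the other two parts are singletons, and minimum degree K + 1 gives exactly the
        required 2K.\<close>
      proof (cases "\<forall>U\<in>P. card U \<le> 2 * m - 3")
        case True
        then have "4 * int (card E) \<le> 4 * int c + ((2 * int m - 2) * (2 * int m) - (2 * int m - 3) * 3)"
          using size[of "2 * m - 3"] K 3 by (simp add: of_nat_diff)
        then have "4 * int m - 9 \<le> 4 * int c"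
          using dense' by (simp add: algebra_simps power2_eq_square)
        then show ?thesis using K 3 by simp
      next
        case False
        then obtain U where U: "U \<in> P" "card U > 2 * m - 3" by auto
        have "card (A \<union> B - U) = 2"
          using small(2)[OF U(1)] part_le[OF U(1)] U(2) 3 by linarith
        then show ?thesis using small(1)[OF U(1)] 3 by (simp add: mult.commute)
      qed
    qed
  qed
  then show ?thesis by (simp add: t_def c_def)
qed

section \<open>Eigenvalues of real symmetric and nonnegative matrices\<close>

lemma quadratic_form_max_on_sphere:
  fixes M :: "nat \<Rightarrow> nat \<Rightarrow> real"
  assumes "n > 0"
  obtains x where "(\<Sum>i<n. (x i)\<^sup>2) = 1"
    "\<And>y. (\<Sum>i<n. (y i)\<^sup>2) = 1 \<Longrightarrow>
       (\<Sum>i<n. \<Sum>j<n. M i j * y i * y j) \<le> (\<Sum>i<n. \<Sum>j<n. M i j * x i * x j)"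
proof -
  define Q where "Q x = (\<Sum>i<n. \<Sum>j<n. M i j * x i * x j)" for x :: "nat \<Rightarrow> real"
  define N where "N x = (\<Sum>i<n. (x i)\<^sup>2)" for x :: "nat \<Rightarrow> real"
  \<comment> \<open>Vectors are functions on all naturals; fixing the coordinates from
    \<open>n\<close> on at 0 makes the box a product of compact sets, compact by Tychonoff's
    theorem.\<close>
  define box :: "(nat \<Rightarrow> real) set" where "box = Pi\<^sub>E UNIV (\<lambda>i. if i < n then {-1..1} else {0})"
  have "compactin (product_topology (\<lambda>_. euclidean) UNIV) box"
    unfolding box_def compactin_PiE by auto
  then have "compact box" by (simp add: euclidean_product_topology)
  have cont: "continuous_on UNIV Q" "continuous_on UNIV N"
    unfolding Q_def N_def by (intro continuous_intros continuous_on_product_coordinates)+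
  have "closed (N -` {1})" using cont(2) by (intro closed_vimage) auto
  then have cpt: "compact (box \<inter> N -` {1})" using \<open>compact box\<close> by blast
  have "N (\<lambda>i. if i = 0 then 1 else 0) = 1"
    using assms by (simp add: N_def if_distrib[of "\<lambda>x. x\<^sup>2"] cong: if_cong)
  then have ne: "(\<lambda>i. if i = 0 then 1 else 0) \<in> box \<inter> N -` {1}"
    using assms by (auto simp: box_def PiE_iff)
  obtain x where x: "x \<in> box \<inter> N -` {1}" "\<And>y. y \<in> box \<inter> N -` {1} \<Longrightarrow> Q y \<le> Q x"
    using continuous_attains_sup[OF cpt _ continuous_on_subset[OF cont(1)]] ne by blast
  show thesis
  proof
    show "(\<Sum>i<n. (x i)\<^sup>2) = 1" using x(1) by (simp add: N_def)
    fix y :: "nat \<Rightarrow> real" assume y: "(\<Sum>i<n. (y i)\<^sup>2) = 1"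
    define z where "z i = (if i < n then y i else 0)" for i
    have "(y i)\<^sup>2 \<le> 1" if "i < n" for i
      using member_le_sum[of i "{..<n}" "\<lambda>i. (y i)\<^sup>2"] that y by simp
    then have "z \<in> box" by (auto simp: box_def PiE_iff z_def abs_le_iff abs_square_le_1)
    moreover have "N z = 1" using y by (simp add: N_def z_def)
    moreover have "Q z = Q y" by (simp add: Q_def z_def)
    ultimately show "(\<Sum>i<n. \<Sum>j<n. M i j * y i * y j) \<le> (\<Sum>i<n. \<Sum>j<n. M i j * x i * x j)"
      using x(2)[of z] by (simp add: Q_def)
  qed
qed

lemma linear_nonneg_imp_zero:
  fixes a b :: real
  assumes "\<And>t. 0 \<le> t * a + t\<^sup>2 * b"
  shows "a = 0"
proof (rule ccontr)
  assume "a \<noteq> 0"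
  define c where "c = \<bar>b\<bar> + 1"
  have c: "c > 0" "b < c" by (auto simp: c_def)
  \<comment> \<open>At t = -a/c the expression equals (a/c)^2 (b - c), and \<open>c\<close> was
    chosen positive and above \<open>b\<close>.\<close>
  have "0 \<le> (- a / c) * a + (- a / c)\<^sup>2 * b" by (rule assms)
  then have "0 \<le> (a / c)\<^sup>2 * (b - c)" using c by (simp add: power2_eq_square field_simps)
  moreover have "(a / c)\<^sup>2 * (b - c) < 0"
    using c \<open>a \<noteq> 0\<close> by (intro mult_pos_neg) auto
  ultimately show False by simp
qed

text \<open>At a maximiser of the quadratic form on the unit sphere the first variation vanishes in
  every coordinate direction, which is the eigenvector equation row by row; the maximum is the
  eigenvalue.\<close>

lemma symmetric_rayleigh_eigenvector:
  fixes M :: "nat \<Rightarrow> nat \<Rightarrow> real"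
  assumes "n > 0" and sym: "\<And>i j. i < n \<Longrightarrow> j < n \<Longrightarrow> M i j = M j i"
  obtains x \<mu> where "\<exists>i<n. x i \<noteq> 0" "\<And>i. i < n \<Longrightarrow> (\<Sum>j<n. M i j * x j) = \<mu> * x i"
    "\<And>y. (\<Sum>i<n. \<Sum>j<n. M i j * y i * y j) \<le> \<mu> * (\<Sum>i<n. (y i)\<^sup>2)"
proof -
  define Q where "Q x = (\<Sum>i<n. \<Sum>j<n. M i j * x i * x j)" for x :: "nat \<Rightarrow> real"
  define N where "N x = (\<Sum>i<n. (x i)\<^sup>2)" for x :: "nat \<Rightarrow> real"
  obtain x where x: "N x = 1" "\<And>y. N y = 1 \<Longrightarrow> Q y \<le> Q x"
    unfolding Q_def N_def by (rule quadratic_form_max_on_sphere[OF assms(1), of M]) blast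
  have Q_le: "Q y \<le> Q x * N y" for y
  proof (cases "N y = 0")
    case True
    then have "y i = 0" if "i < n" for i using that by (simp add: N_def sum_nonneg_eq_0_iff)
    then show ?thesis using True by (simp add: Q_def)
  next
    case False
    then have pos: "N y > 0" using sum_nonneg[of "{..<n}" "\<lambda>i. (y i)\<^sup>2"] by (simp add: N_def)
    define s where "s = 1 / sqrt (N y)"
    have s2: "s\<^sup>2 = 1 / N y" using pos by (simp add: s_def power_divide)
    have "N (\<lambda>i. s * y i) = s\<^sup>2 * N y"
      by (simp add: N_def power_mult_distrib sum_distrib_left)
    then have "Q (\<lambda>i. s * y i) \<le> Q x" using x(2) s2 pos by simp
    moreover have "Q (\<lambda>i. s * y i) = s\<^sup>2 * Q y"
      by (simp add: Q_def sum_distrib_left power2_eq_square mult_ac)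
    ultimately show ?thesis using pos s2 by (simp add: field_simps)
  qed
  have eig: "(\<Sum>j<n. M i j * x j) = Q x * x i" if i: "i < n" for i
  proof -
    define e where "e j = (if j = i then 1 else 0 :: real)" for j
    have pick: "(\<Sum>j<n. a j * e j) = a i" for a
    proof -
      have "(\<Sum>j<n. a j * e j) = (\<Sum>j<n. if j = i then a j else 0)"
        by (intro sum.cong) (auto simp: e_def)
      then show ?thesis using i by simp
    qed
    define R where "R = (\<Sum>j<n. M i j * x j)"
    have N_eq: "N (\<lambda>j. x j + t * e j) = 1 + 2 * t * x i + t\<^sup>2" for t
    proof -
      have "N (\<lambda>j. x j + t * e j) = N x + 2 * t * (\<Sum>j<n. x j * e j) + t\<^sup>2 * (\<Sum>j<n. 1 * e j)"
        unfolding N_def sum_distrib_left sum.distrib[symmetric]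
        by (intro sum.cong) (auto simp: e_def power2_eq_square algebra_simps)
      then show ?thesis unfolding pick using x(1) by simp
    qed
    have Q_eq: "Q (\<lambda>j. x j + t * e j) = Q x + 2 * t * R + t\<^sup>2 * M i i" for t
    proof -
      have "Q (\<lambda>j. x j + t * e j) = Q x + t * (\<Sum>k<n. \<Sum>j<n. M k j * x k * e j)
          + t * (\<Sum>k<n. \<Sum>j<n. M k j * e k * x j) + t\<^sup>2 * (\<Sum>k<n. \<Sum>j<n. M k j * e k * e j)"
        unfolding Q_def sum_distrib_left sum.distrib[symmetric]
        by (intro sum.cong) (auto simp: power2_eq_square algebra_simps)
      moreover have "(\<Sum>k<n. \<Sum>j<n. M k j * x k * e j) = R"
        unfolding pick R_def using i sym by (intro sum.cong) auto
      moreover have "(\<Sum>k<n. \<Sum>j<n. M k j * e k * x j) = R"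
      proof -
        have "(\<Sum>j<n. M k j * e k * x j) = (\<Sum>j<n. M k j * x j) * e k" for k
          by (simp add: sum_distrib_left sum_distrib_right mult_ac)
        then show ?thesis by (simp only: pick R_def)
      qed
      moreover have "(\<Sum>k<n. \<Sum>j<n. M k j * e k * e j) = M i i"
        by (simp only: pick)
      ultimately show ?thesis by simp
    qed
    have "0 \<le> t * (2 * (Q x * x i - R)) + t\<^sup>2 * (Q x - M i i)" for t
      using Q_le[of "\<lambda>j. x j + t * e j"] unfolding N_eq Q_eq by (simp add: algebra_simps)
    then have "2 * (Q x * x i - R) = 0" by (rule linear_nonneg_imp_zero)
    then show ?thesis by (simp add: R_def)
  qed
  have "\<exists>i<n. x i \<noteq> 0"
  proof (rule ccontr)
    assume "\<not> (\<exists>i<n. x i \<noteq> 0)"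
    then show False using x(1) by (simp add: N_def)
  qed
  then show thesis using eig Q_le that[of x "Q x"] unfolding Q_def N_def by blast
qed

section \<open>Eigenvalue bounds for matrices given by functions on indices\<close>

lemma mat_mult_vec_fun:
  fixes M :: "nat \<Rightarrow> nat \<Rightarrow> real"
  assumes "i < n"
  shows "(mat n n (\<lambda>(i, j). M i j) *\<^sub>v vec n x) $ i = (\<Sum>j<n. M i j * x j)"
  using assms by (simp add: scalar_prod_def atLeast0LessThan)

lemma finite_eigenvalues:
  fixes A :: "real mat"
  assumes "A \<in> carrier_mat n n"
  shows "finite {x. eigenvalue A x}"
proof -
  have "char_poly A \<noteq> 0" using degree_monic_char_poly[OF assms] by auto
  then show ?thesis using poly_roots_finite by (simp add: eigenvalue_root_char_poly[OF assms])
qed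

lemma eigenvalue_ge_rayleigh:
  fixes M :: "nat \<Rightarrow> nat \<Rightarrow> real"
  assumes "n > 0" and sym: "\<And>i j. i < n \<Longrightarrow> j < n \<Longrightarrow> M i j = M j i"
  obtains \<mu> where "eigenvalue (mat n n (\<lambda>(i, j). M i j)) \<mu>"
    "\<And>y. (\<Sum>i<n. \<Sum>j<n. M i j * y i * y j) \<le> \<mu> * (\<Sum>i<n. (y i)\<^sup>2)"
proof -
  obtain x \<mu> where x: "\<exists>i<n. x i \<noteq> 0" "\<And>i. i < n \<Longrightarrow> (\<Sum>j<n. M i j * x j) = \<mu> * x i"
    and le: "\<And>y. (\<Sum>i<n. \<Sum>j<n. M i j * y i * y j) \<le> \<mu> * (\<Sum>i<n. (y i)\<^sup>2)"
    using symmetric_rayleigh_eigenvector[of n M] assms by blast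
  have "eigenvector (mat n n (\<lambda>(i, j). M i j)) (vec n x) \<mu>"
    unfolding eigenvector_def
  proof (intro conjI)
    obtain i where i: "i < n" "x i \<noteq> 0" using x(1) by blast
    then have "vec n x $ i \<noteq> 0\<^sub>v n $ i" by simp
    then show "vec n x \<noteq> 0\<^sub>v (dim_row (mat n n (\<lambda>(i, j). M i j)))" by auto
    show "mat n n (\<lambda>(i, j). M i j) *\<^sub>v vec n x = \<mu> \<cdot>\<^sub>v vec n x"
    proof (rule eq_vecI)
      fix i assume "i < dim_vec (\<mu> \<cdot>\<^sub>v vec n x)"
      then have "i < n" by simp
      then show "(mat n n (\<lambda>(i, j). M i j) *\<^sub>v vec n x) $ i = (\<mu> \<cdot>\<^sub>v vec n x) $ i"
        using mat_mult_vec_fun[of i n M x] x(2)[of i] by simp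
    qed simp
  qed simp
  then show thesis using le that unfolding eigenvalue_def by blast
qed

text \<open>Compare an eigenvector with \<open>x\<close> at the index maximising the ratio of their entries.\<close>

lemma eigenvalue_le_of_supersolution:
  fixes M :: "nat \<Rightarrow> nat \<Rightarrow> real"
  assumes nonneg: "\<And>i j. i < n \<Longrightarrow> j < n \<Longrightarrow> 0 \<le> M i j"
    and x: "\<And>i. i < n \<Longrightarrow> 0 < x i" "\<And>i. i < n \<Longrightarrow> (\<Sum>j<n. M i j * x j) \<le> c * x i"
    and ev: "eigenvalue (mat n n (\<lambda>(i, j). M i j)) \<mu>"
  shows "\<mu> \<le> c"
proof -
  obtain v where v: "v \<in> carrier_vec n" "v \<noteq> 0\<^sub>v n" "mat n n (\<lambda>(i, j). M i j) *\<^sub>v v = \<mu> \<cdot>\<^sub>v v"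
    using ev by (auto simp: eigenvalue_def eigenvector_def)
  define y where "y i = v $ i" for i
  have vy: "v = vec n y" using v(1) by (auto simp: y_def)
  have eig: "(\<Sum>j<n. M i j * y j) = \<mu> * y i" if "i < n" for i
  proof -
    have "(mat n n (\<lambda>(i, j). M i j) *\<^sub>v vec n y) $ i = (\<mu> \<cdot>\<^sub>v vec n y) $ i"
      using v(3) vy by simp
    then show ?thesis unfolding mat_mult_vec_fun[OF that] using that by simp
  qed
  have "\<exists>i<n. y i \<noteq> 0"
  proof (rule ccontr)
    assume "\<not> (\<exists>i<n. y i \<noteq> 0)"
    then have "v = 0\<^sub>v n" unfolding vy by auto
    then show False using v(2) by simp
  qed
  then obtain i0 where i0: "i0 < n" "y i0 \<noteq> 0" by blast
  define r where "r = Max ((\<lambda>i. \<bar>y i\<bar> / x i) ` {..<n})"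
  have "r \<in> (\<lambda>i. \<bar>y i\<bar> / x i) ` {..<n}"
    unfolding r_def using i0 by (intro Max_in) auto
  then obtain i where i: "i < n" "r = \<bar>y i\<bar> / x i" by auto
  have r: "\<bar>y j\<bar> \<le> r * x j" if "j < n" for j
  proof -
    have "\<bar>y j\<bar> / x j \<le> r" unfolding r_def using that by (intro Max_ge) auto
    then show ?thesis using x(1)[OF that] by (simp add: field_simps)
  qed
  have "0 < r * x i0" using r[OF i0(1)] i0(2) by linarith
  then have "r > 0" using x(1)[OF i0(1)] by (simp add: zero_less_mult_iff)
  then have pos: "\<bar>y i\<bar> > 0" and yi: "\<bar>y i\<bar> = r * x i" using i x(1)[OF i(1)] by auto
  have "\<mu> * \<bar>y i\<bar> \<le> \<bar>\<mu> * y i\<bar>" by (simp add: abs_mult mult_right_mono)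
  also have "\<dots> = \<bar>\<Sum>j<n. M i j * y j\<bar>" using eig[OF i(1)] by simp
  also have "\<dots> \<le> (\<Sum>j<n. \<bar>M i j * y j\<bar>)" by (rule sum_abs)
  also have "\<dots> \<le> (\<Sum>j<n. M i j * (r * x j))"
  proof (rule sum_mono)
    fix j assume "j \<in> {..<n}"
    then show "\<bar>M i j * y j\<bar> \<le> M i j * (r * x j)"
      using nonneg[OF i(1), of j] r[of j] by (simp add: abs_mult mult_left_mono)
  qed
  also have "\<dots> = r * (\<Sum>j<n. M i j * x j)" by (simp add: sum_distrib_left mult_ac)
  also have "\<dots> \<le> r * (c * x i)" using x(2)[OF i(1)] \<open>r > 0\<close> by simp
  also have "\<dots> = c * \<bar>y i\<bar>" using yi by simp
  finally show ?thesis using pos by simp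
qed

section \<open>Distance matrices\<close>

lemma vertex_enum:
  assumes "finite (verts G)"
  shows "bij_betw (\<lambda>i. vertex_enum G ! i) {..<card (verts G)} (verts G)"
proof -
  have "\<exists>vs. distinct vs \<and> set vs = verts G" using finite_distinct_list[OF assms] by blast
  then have vs: "distinct (vertex_enum G)" "set (vertex_enum G) = verts G"
    unfolding vertex_enum_def by (metis (mono_tags, lifting) someI_ex)+
  moreover have "length (vertex_enum G) = card (verts G)" using vs distinct_card by metis
  ultimately show ?thesis by (intro bij_betw_nth) auto
qed

lemma path_between_rev:
  assumes "path_between G u p v"
  shows "path_between G v (rev p) u"
proof -
  have "{rev p ! i, rev p ! Suc i} \<in> edges G" if "Suc i < length p" for i
  proof -
    define j where "j = length p - Suc (Suc i)"
    have j: "Suc j < length p" "length p - Suc i = Suc j" using that by (auto simp: j_def)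
    then have "{p ! j, p ! Suc j} \<in> edges G" using assms by (simp add: path_between_def)
    then show ?thesis using that j by (simp add: rev_nth j_def insert_commute)
  qed
  then show ?thesis using assms by (auto simp: path_between_def hd_rev last_rev)
qed

lemma graph_dist_commute: "graph_dist G u v = graph_dist G v u"
proof -
  have "(\<exists>p. path_between G u p v \<and> length p = Suc l) \<longleftrightarrow>
      (\<exists>p. path_between G v p u \<and> length p = Suc l)" for l
    using path_between_rev length_rev by metis
  then show ?thesis by (simp add: graph_dist_def)
qed

lemma graph_dist_le:
  assumes "path_between G u p v" "length p = Suc l"
  shows "graph_dist G u v \<le> l"
  unfolding graph_dist_def using assms by (intro Least_le) blast

lemma graph_dist_path:
  assumes "connected_graph G" "u \<in> verts G" "v \<in> verts G"
  obtains p where "path_between G u p v" "length p = Suc (graph_dist G u v)"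
proof -
  obtain p where p: "path_between G u p v" using assms by (auto simp: connected_graph_def)
  then have "length p = Suc (length p - 1)" by (cases p) (auto simp: path_between_def)
  with p have "\<exists>l p. path_between G u p v \<and> length p = Suc l" by blast
  from LeastI_ex[OF this] that show thesis unfolding graph_dist_def by blast
qed

lemma distance_matrix_eq:
  "distance_matrix G = mat (card (verts G)) (card (verts G))
     (\<lambda>(i, j). (\<lambda>i j. real (graph_dist G (vertex_enum G ! i) (vertex_enum G ! j))) i j)"
  by (simp add: distance_matrix_def)

lemma finite_distance_eigenvalues: "finite {x. eigenvalue (distance_matrix G) x}"
  by (rule finite_eigenvalues[of _ "card (verts G)"]) (simp add: distance_matrix_def)

text \<open>This is the Rayleigh bound at the all-ones vector. The second claim ensures that the
  \<open>Max\<close> defining the spectral radius is attained, as the upper bound below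
  requires.\<close>

lemma distance_spectral_radius_ge:
  assumes "finite (verts G)" "verts G \<noteq> {}"
  shows "(\<Sum>u\<in>verts G. \<Sum>v\<in>verts G. real (graph_dist G u v))
    \<le> distance_spectral_radius G * real (card (verts G))"
    and "{x. eigenvalue (distance_matrix G) x} \<noteq> {}"
proof -
  define n where "n = card (verts G)"
  define M where "M i j = real (graph_dist G (vertex_enum G ! i) (vertex_enum G ! j))" for i j
  have "n > 0" using assms by (simp add: n_def card_gt_0_iff)
  moreover have "M i j = M j i" for i j by (simp add: M_def graph_dist_commute)
  ultimately obtain \<mu> where \<mu>: "eigenvalue (mat n n (\<lambda>(i, j). M i j)) \<mu>"
    and le: "\<And>y. (\<Sum>i<n. \<Sum>j<n. M i j * y i * y j) \<le> \<mu> * (\<Sum>i<n. (y i)\<^sup>2)"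
    using eigenvalue_ge_rayleigh[of n M] by blast
  have ev: "eigenvalue (distance_matrix G) \<mu>"
    using \<mu> by (simp add: distance_matrix_eq M_def n_def)
  then show "{x. eigenvalue (distance_matrix G) x} \<noteq> {}" by blast
  have "\<mu> \<le> distance_spectral_radius G"
    unfolding distance_spectral_radius_def using ev finite_distance_eigenvalues by (intro Max_ge) auto
  note reindex = sum.reindex_bij_betw[OF vertex_enum[OF assms(1)]]
  have "(\<Sum>i<n. \<Sum>j<n. M i j) \<le> \<mu> * real n" using le[of "\<lambda>_. 1"] by simp
  also have "\<dots> \<le> distance_spectral_radius G * real n"
    using \<open>\<mu> \<le> distance_spectral_radius G\<close> by (simp add: mult_right_mono)
  also have "(\<Sum>i<n. \<Sum>j<n. M i j) = (\<Sum>u\<in>verts G. \<Sum>v\<in>verts G. real (graph_dist G u v))"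
    unfolding M_def n_def
    by (subst reindex[of "\<lambda>v. real (graph_dist G _ v)"], rule reindex)
  finally show "(\<Sum>u\<in>verts G. \<Sum>v\<in>verts G. real (graph_dist G u v))
    \<le> distance_spectral_radius G * real (card (verts G))" by (simp add: n_def)
qed

lemma distance_spectral_radius_le:
  assumes G: "finite (verts G)" "verts G \<noteq> {}"
    and x: "\<And>u. u \<in> verts G \<Longrightarrow> 0 < x u"
      "\<And>u. u \<in> verts G \<Longrightarrow> (\<Sum>v\<in>verts G. real (graph_dist G u v) * x v) \<le> c * x u"
  shows "distance_spectral_radius G \<le> c"
proof -
  define n where "n = card (verts G)"
  define M where "M i j = real (graph_dist G (vertex_enum G ! i) (vertex_enum G ! j))" for i j
  have vs: "vertex_enum G ! i \<in> verts G" if "i < n" for i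
    using vertex_enum[OF G(1)] that by (auto simp: bij_betw_def n_def)
  note reindex = sum.reindex_bij_betw[OF vertex_enum[OF G(1)]]
  have "\<mu> \<le> c" if ev: "eigenvalue (distance_matrix G) \<mu>" for \<mu>
  proof (rule eigenvalue_le_of_supersolution[of n M "\<lambda>i. x (vertex_enum G ! i)"])
    show "eigenvalue (mat n n (\<lambda>(i, j). M i j)) \<mu>"
      using ev by (simp add: distance_matrix_eq M_def n_def)
    show "(\<Sum>j<n. M i j * x (vertex_enum G ! j)) \<le> c * x (vertex_enum G ! i)" if "i < n" for i
      using x(2)[OF vs[OF that]] reindex[of "\<lambda>v. real (graph_dist G (vertex_enum G ! i) v) * x v"]
      by (simp add: M_def n_def)
  qed (use x(1) vs in \<open>auto simp: M_def\<close>)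
  moreover have "distance_spectral_radius G \<in> {x. eigenvalue (distance_matrix G) x}"
    unfolding distance_spectral_radius_def
    using finite_distance_eigenvalues distance_spectral_radius_ge(2)[OF G] by (intro Max_in)
  ultimately show ?thesis by simp
qed

section \<open>Distances in bipartite graphs\<close>

lemma bipartite_path_parity:
  assumes bip: "\<And>e. e \<in> edges G \<Longrightarrow> \<exists>a\<in>A. \<exists>b\<in>B. e = {a, b}" and "A \<inter> B = {}"
    and "path_between G u p v" "i < length p"
  shows "p ! i \<in> A \<longleftrightarrow> (u \<in> A \<longleftrightarrow> even i)"
  using assms(4)
proof (induction i)
  case 0
  then show ?case using assms(3) by (auto simp: path_between_def hd_conv_nth)
next
  case (Suc i)
  have "{p ! i, p ! Suc i} \<in> edges G" using assms(3) Suc.prems by (simp add: path_between_def)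
  then obtain a b where "a \<in> A" "b \<in> B" "{p ! i, p ! Suc i} = {a, b}" using bip by blast
  then have "p ! Suc i \<in> A \<longleftrightarrow> p ! i \<notin> A"
    using assms(2) by (auto simp: doubleton_eq_iff)
  then show ?case using Suc by auto
qed

text \<open>Each edge changes sides, so distances are even within a side and odd across; a
  nonadjacent pair across cannot be at distance 1.\<close>

lemma bipartite_dist_lower:
  assumes bip: "\<And>e. e \<in> edges G \<Longrightarrow> \<exists>a\<in>A. \<exists>b\<in>B. e = {a, b}" and "A \<inter> B = {}"
    and "connected_graph G" and uv: "u \<in> verts G" "v \<in> verts G"
  shows "u \<in> A \<longleftrightarrow> v \<in> A \<Longrightarrow> u \<noteq> v \<Longrightarrow> 2 \<le> graph_dist G u v"
    and "u \<in> A \<longleftrightarrow> v \<notin> A \<Longrightarrow> 1 \<le> graph_dist G u v"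
    and "u \<in> A \<longleftrightarrow> v \<notin> A \<Longrightarrow> {u, v} \<notin> edges G \<Longrightarrow> 3 \<le> graph_dist G u v"
proof -
  define d where "d = graph_dist G u v"
  obtain p where p: "path_between G u p v" "length p = Suc d"
    using graph_dist_path[OF assms(3) uv] by (metis d_def)
  have ends: "p ! 0 = u" "p ! d = v"
    using p by (auto simp: path_between_def hd_conv_nth last_conv_nth)
  have parity: "v \<in> A \<longleftrightarrow> (u \<in> A \<longleftrightarrow> even d)"
    using bipartite_path_parity[OF bip assms(2) p(1), of d] p(2) ends by simp
  have d0: "d \<noteq> 0" if "u \<noteq> v" using ends that by metis
  have d1: "d \<noteq> 1" if "{u, v} \<notin> edges G"
  proof
    assume "d = 1"
    then have "{p ! 0, p ! Suc 0} \<in> edges G" using p by (simp add: path_between_def)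
    then show False using that ends \<open>d = 1\<close> by simp
  qed
  show "2 \<le> graph_dist G u v" if "u \<in> A \<longleftrightarrow> v \<in> A" "u \<noteq> v"
  proof -
    have "even d" using parity that by blast
    then show ?thesis using d0[OF that(2)] unfolding d_def[symmetric] by (cases "d = 1") auto
  qed
  show "1 \<le> graph_dist G u v" if "u \<in> A \<longleftrightarrow> v \<notin> A"
  proof -
    have "odd d" using parity that by blast
    then show ?thesis unfolding d_def[symmetric] by presburger
  qed
  show "3 \<le> graph_dist G u v" if "u \<in> A \<longleftrightarrow> v \<notin> A" "{u, v} \<notin> edges G"
  proof -
    have "odd d" using parity that by blast
    then have "d \<noteq> 0" "d \<noteq> 2" by presburger+
    then show ?thesis using d1[OF that(2)] unfolding d_def[symmetric] by linarith
  qed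
qed

text \<open>The own side contributes at least 2 (m - 1); on the other side neighbours contribute at
  least 1 and all other vertices at least 3.\<close>

lemma bipartite_transmission_ge:
  assumes bip: "\<And>e. e \<in> edges G \<Longrightarrow> \<exists>a\<in>A. \<exists>b\<in>B. e = {a, b}" and "A \<inter> B = {}"
    and G: "connected_graph G" "simple_graph G" "verts G = A \<union> B"
    and card: "card A = m" "card B = m" and u: "u \<in> A"
  shows "5 * real m - 2 - 2 * real (vertex_degree G u) \<le> (\<Sum>v\<in>A \<union> B. real (graph_dist G u v))"
proof -
  have fin: "finite A" "finite B" using G(2,3) by (auto simp: simple_graph_def)
  have "edges G \<subseteq> Pow (verts G)" using G(2) by (auto simp: simple_graph_def)
  then have finE: "finite (edges G)" using G(3) fin by (simp add: finite_subset)
  note lower = bipartite_dist_lower[OF bip assms(2) G(1)]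
  have same: "(\<Sum>v\<in>A. real (graph_dist G u v)) \<ge> 2 * real m - 2"
  proof -
    have "(\<Sum>v\<in>A. 2 - (if v = u then 2 else 0)) \<le> (\<Sum>v\<in>A. real (graph_dist G u v))"
    proof (rule sum_mono)
      fix v assume "v \<in> A"
      then show "2 - (if v = u then 2 else 0) \<le> real (graph_dist G u v)"
        using lower(1)[of u v] u G(3) by auto
    qed
    then show ?thesis using u fin card by (simp add: sum_subtractf)
  qed
  define N where "N = {v \<in> B. {u, v} \<in> edges G}"
  have "card N \<le> vertex_degree G u"
    unfolding vertex_degree_def
  proof (rule card_inj_on_le)
    show "inj_on (\<lambda>v. {u, v}) N" by (auto simp: inj_on_def doubleton_eq_iff)
    show "(\<lambda>v. {u, v}) ` N \<subseteq> {e \<in> edges G. u \<in> e}" by (auto simp: N_def)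
  qed (use finE in simp)
  moreover have "(\<Sum>v\<in>B. real (graph_dist G u v)) \<ge> 3 * real m - 2 * real (card N)"
  proof -
    have "(\<Sum>v\<in>B. 3 - (if v \<in> N then 2 else 0)) \<le> (\<Sum>v\<in>B. real (graph_dist G u v))"
    proof (rule sum_mono)
      fix v assume v: "v \<in> B"
      then have "v \<notin> A" using assms(2) by auto
      then show "3 - (if v \<in> N then 2 else 0) \<le> real (graph_dist G u v)"
        using lower(2,3)[of u v] u v G(3) by (auto simp: N_def)
    qed
    moreover have "(\<Sum>v\<in>B. if v \<in> N then 2 else 0 :: real) = 2 * real (card N)"
    proof -
      have "B \<inter> N = N" by (auto simp: N_def)
      then show ?thesis using fin by (simp add: sum.If_cases)
    qed
    ultimately show ?thesis using card by (simp add: sum_subtractf)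
  qed
  ultimately show ?thesis using same fin assms(2) by (simp add: sum.union_disjoint)
qed

lemma sum_vertex_degree:
  assumes "simple_graph G"
  shows "(\<Sum>v\<in>verts G. vertex_degree G v) = 2 * card (edges G)"
proof -
  have fin: "finite (verts G)" using assms by (simp add: simple_graph_def)
  have "edges G \<subseteq> Pow (verts G)" using assms by (auto simp: simple_graph_def)
  then have finE: "finite (edges G)" using fin by (simp add: finite_subset)
  have "(\<Sum>v\<in>verts G. vertex_degree G v) = (\<Sum>v\<in>verts G. \<Sum>e | e \<in> edges G \<and> v \<in> e. 1)"
    by (simp add: vertex_degree_def)
  also have "\<dots> = (\<Sum>e\<in>edges G. \<Sum>v | v \<in> verts G \<and> v \<in> e. 1)"
    using fin finE by (rule sum.swap_restrict)
  also have "\<dots> = (\<Sum>e\<in>edges G. 2)"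
  proof (rule sum.cong)
    fix e assume "e \<in> edges G"
    then have "{v. v \<in> verts G \<and> v \<in> e} = e" "card e = 2"
      using assms by (auto simp: simple_graph_def)
    then show "(\<Sum>v | v \<in> verts G \<and> v \<in> e. 1) = (2 :: nat)" by simp
  qed simp
  finally show ?thesis by simp
qed

lemma distance_spectral_radius_bipartite_ge:
  assumes bip: "\<And>e. e \<in> edges G \<Longrightarrow> \<exists>a\<in>A. \<exists>b\<in>B. e = {a, b}" and "A \<inter> B = {}"
    and G: "connected_graph G" "simple_graph G" "verts G = A \<union> B"
    and card: "card A = m" "card B = m"
  shows "10 * (real m)\<^sup>2 - 4 * real m - 4 * real (card (edges G))
    \<le> distance_spectral_radius G * (2 * real m)"
proof -
  have fin: "finite A" "finite B" using G(2,3) by (auto simp: simple_graph_def)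
  have V: "card (verts G) = 2 * m" using G(3) fin card assms(2) by (simp add: card_Un_disjoint)
  have bip': "\<exists>b\<in>B. \<exists>a\<in>A. e = {b, a}" if "e \<in> edges G" for e
    using bip[OF that] by (metis insert_commute)
  have row: "5 * real m - 2 - 2 * real (vertex_degree G u) \<le> (\<Sum>v\<in>verts G. real (graph_dist G u v))"
    if "u \<in> verts G" for u
  proof (cases "u \<in> A")
    case True
    then show ?thesis using bipartite_transmission_ge[OF bip assms(2) G card] G(3) by simp
  next
    case False
    then have "u \<in> B" using that G(3) by simp
    moreover have "B \<inter> A = {}" "verts G = B \<union> A" using assms(2) G(3) by auto
    ultimately show ?thesis
      using bipartite_transmission_ge[OF bip' _ G(1,2) _ card(2,1)] by simp
  qed
  have "(\<Sum>u\<in>verts G. 5 * real m - 2 - 2 * real (vertex_degree G u))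
      = 2 * real m * (5 * real m - 2) - 2 * real (\<Sum>u\<in>verts G. vertex_degree G u)"
    by (simp only: sum_subtractf sum_constant V of_nat_sum sum_distrib_left)
      (simp add: algebra_simps)
  also have "\<dots> = 10 * (real m)\<^sup>2 - 4 * real m - 4 * real (card (edges G))"
    unfolding sum_vertex_degree[OF G(2)] by (simp add: power2_eq_square algebra_simps)
  finally have "10 * (real m)\<^sup>2 - 4 * real m - 4 * real (card (edges G))
      \<le> (\<Sum>u\<in>verts G. \<Sum>v\<in>verts G. real (graph_dist G u v))"
    using row by (metis (no_types, lifting) sum_mono)
  also have "\<dots> \<le> distance_spectral_radius G * real (card (verts G))"
    using G by (intro distance_spectral_radius_ge) (auto simp: simple_graph_def connected_graph_def)
  finally show ?thesis by (simp add: V)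
qed

section \<open>The extremal graph\<close>

lemma verts_bipartite_minus_star: "verts (bipartite_minus_star m r) = {..<2 * m}"
  by (auto simp: bipartite_minus_star_def delete_edges_def complete_bipartite_def)

lemma edges_bipartite_minus_starI:
  assumes "a < m" "m \<le> b" "b < 2 * m" "a \<noteq> 0 \<or> m + r \<le> b"
  shows "{a, b} \<in> edges (bipartite_minus_star m r)" "{b, a} \<in> edges (bipartite_minus_star m r)"
proof -
  show "{a, b} \<in> edges (bipartite_minus_star m r)"
    using assms
    by (auto simp: bipartite_minus_star_def delete_edges_def complete_bipartite_def doubleton_eq_iff)
  then show "{b, a} \<in> edges (bipartite_minus_star m r)" by (simp add: insert_commute)
qed

lemma path_between_singleton: "u \<in> verts G \<Longrightarrow> path_between G u [u] u"
  by (simp add: path_between_def)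

text \<open>The diagonal value is 2 instead of 0, so that a row depends only on the class of the
  column vertex; the excess \<open>2 * x u\<close> is subtracted when rows are summed.\<close>

definition star_dist :: "nat \<Rightarrow> nat \<Rightarrow> nat \<Rightarrow> nat \<Rightarrow> real" where
  "star_dist m r u v = (if u < m \<longleftrightarrow> v < m then 2
     else if u = 0 \<and> v < m + r \<or> v = 0 \<and> u < m + r then 3 else 1)"

text \<open>Vertex \<open>2 * m - 1\<close> is not a leaf as r < m, and vertex \<open>1\<close> is
  not the centre as 2 <= m, so each is adjacent to the whole opposite part and serves as a hub.
  Upper bounds suffice, since distances enter the row sums with positive weights.\<close>

lemma graph_dist_bipartite_minus_star_le:
  assumes "r < m" "2 \<le> m" "u < 2 * m" "v < 2 * m" "u \<noteq> v"
  shows "real (graph_dist (bipartite_minus_star m r) u v) \<le> star_dist m r u v"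
proof -
  let ?H = "bipartite_minus_star m r"
  note E = edges_bipartite_minus_starI
  have *: "real (graph_dist ?H u v) \<le> star_dist m r u v"
    if uv: "u < v" "v < 2 * m" for u v
  proof -
    consider "v < m" | "m \<le> u" | "u < m" "m \<le> v" "u \<noteq> 0 \<or> m + r \<le> v" | "u = 0" "m \<le> v" "v < m + r"
      using uv by linarith
    then show ?thesis
    proof cases
      case 1
      have "{u, 2 * m - 1} \<in> edges ?H" "{2 * m - 1, v} \<in> edges ?H"
        using 1 uv assms(1,2) by (intro E; simp; linarith)+
      then have "path_between ?H u [u, 2 * m - 1, v] v"
        using 1 uv assms(1,2) by (auto simp: path_between_def less_Suc_eq verts_bipartite_minus_star)
      from graph_dist_le[OF this] show ?thesis using 1 uv by (simp add: star_dist_def)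
    next
      case 2
      have "{u, 1} \<in> edges ?H" "{1, v} \<in> edges ?H"
        using 2 uv assms(1,2) by (intro E; simp; linarith)+
      then have "path_between ?H u [u, 1, v] v"
        using 2 uv assms(1,2) by (auto simp: path_between_def less_Suc_eq verts_bipartite_minus_star)
      from graph_dist_le[OF this] show ?thesis using 2 uv by (simp add: star_dist_def)
    next
      case 3
      have "{u, v} \<in> edges ?H"
        using 3 uv assms(1,2) by (intro E; simp; linarith)+
      then have "path_between ?H u [u, v] v"
        using 3 uv assms(1,2) by (auto simp: path_between_def less_Suc_eq verts_bipartite_minus_star)
      from graph_dist_le[OF this] show ?thesis using 3 uv by (auto simp: star_dist_def)
    next
      case 4
      have "{0, 2 * m - 1} \<in> edges ?H" "{2 * m - 1, 1} \<in> edges ?H" "{1, v} \<in> edges ?H"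
        using 4 uv assms(1,2) by (intro E; simp; linarith)+
      then have "path_between ?H 0 [0, 2 * m - 1, 1, v] v"
        using 4 uv assms(1,2) by (auto simp: path_between_def less_Suc_eq verts_bipartite_minus_star)
      from graph_dist_le[OF this] show ?thesis using 4 uv by (simp add: star_dist_def)
    qed
  qed
  show ?thesis
  proof (cases "u < v")
    case True
    then show ?thesis using *[of u v] assms by simp
  next
    case False
    then have "real (graph_dist ?H v u) \<le> star_dist m r v u" using *[of v u] assms by simp
    moreover have "star_dist m r v u = star_dist m r u v" by (auto simp: star_dist_def)
    ultimately show ?thesis by (simp add: graph_dist_commute[of _ u v])
  qed
qed

text \<open>The four classes are the centre, the rest of its part, the leaves of the deleted star
  and the rest of the other part.\<close>

lemma sum_star_classes:
  fixes f :: "nat \<Rightarrow> real"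
  assumes "0 < m" "r \<le> m"
    and "f 0 = a" "\<And>v. 0 < v \<Longrightarrow> v < m \<Longrightarrow> f v = b"
    and "\<And>v. m \<le> v \<Longrightarrow> v < m + r \<Longrightarrow> f v = c" "\<And>v. m + r \<le> v \<Longrightarrow> v < 2 * m \<Longrightarrow> f v = d"
  shows "(\<Sum>v<2 * m. f v) = a + (real m - 1) * b + real r * c + (real m - real r) * d"
proof -
  have "(\<Sum>v<2 * m. f v) = (\<Sum>v\<in>{0..<1}. f v) + (\<Sum>v\<in>{1..<m}. f v)
      + (\<Sum>v\<in>{m..<m + r}. f v) + (\<Sum>v\<in>{m + r..<2 * m}. f v)"
    using assms(1,2) sum.atLeastLessThan_concat[of 0 1 m f]
      sum.atLeastLessThan_concat[of 0 m "m + r" f] sum.atLeastLessThan_concat[of 0 "m + r" "2 * m" f]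
    by (simp add: lessThan_atLeast0)
  also have "(\<Sum>v\<in>{1..<m}. f v) = (\<Sum>v\<in>{1..<m}. b)" using assms(4) by (intro sum.cong) auto
  also have "(\<Sum>v\<in>{m..<m + r}. f v) = (\<Sum>v\<in>{m..<m + r}. c)" using assms(5) by (intro sum.cong) auto
  also have "(\<Sum>v\<in>{m + r..<2 * m}. f v) = (\<Sum>v\<in>{m + r..<2 * m}. d)"
    using assms(6) by (intro sum.cong) auto
  finally show ?thesis using assms(1-3) by (simp add: of_nat_diff)
qed

text \<open>
  For \<open>r\<close> close to \<open>m\<close> the Perron vector, scaled to 1 on the generic vertices, has an entry tending
  to \<open>5 / 3\<close> at the centre and entries \<open>1 + O(1 / m)\<close> at the leaves; hence the test vector.
\<close>

lemma distance_spectral_radius_bipartite_minus_star_le: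
  assumes "r < m" "2 \<le> m"
  shows "distance_spectral_radius (bipartite_minus_star m r) \<le> 3 * real m + 1"
proof -
  let ?H = "bipartite_minus_star m r"
  define x :: "nat \<Rightarrow> real" where
    "x v = (if v = 0 then 5 / 3 else if m \<le> v \<and> v < m + r then 1 + 1 / real m else 1)" for v
  have x_pos: "0 < x v" for v by (auto simp: x_def intro: add_pos_nonneg)
  define q where "q = real r / real m"
  have rm: "q \<le> 1" "real r \<le> real m - 1" using assms by (auto simp: q_def)
  have rz: "real r * (t * (1 + 1 / real m)) = t * real r + t * q" for t
    by (simp add: q_def algebra_simps)
  \<comment> \<open>For the leaf rows: with the diagonal removed such a row sums to 3m + 2 + 2q -
    2/m, to be compared with (3m + 1)(1 + 1/m) = 3m + 4 + 1/m. The extra weight 1/m on leaves pays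
    for the centre's weight 5/3, at distance 3.\<close>
  have "0 \<le> 3 / real m" by simp
  then have q3: "q * 2 \<le> 2 + 3 / real m" using rm(1) by linarith
  show ?thesis
  proof (rule distance_spectral_radius_le[of _ x])
    fix u assume "u \<in> verts ?H"
    then have u: "u < 2 * m" by (simp add: verts_bipartite_minus_star)
    have "(\<Sum>v\<in>verts ?H. real (graph_dist ?H u v) * x v)
        \<le> (\<Sum>v<2 * m. star_dist m r u v * x v - (if v = u then 2 * x v else 0))"
      unfolding verts_bipartite_minus_star
    proof (rule sum_mono)
      fix v assume "v \<in> {..<2 * m}"
      then have v: "v < 2 * m" by simp
      show "real (graph_dist ?H u v) * x v \<le> star_dist m r u v * x v - (if v = u then 2 * x v else 0)"
      proof (cases "v = u")
        case True
        have "graph_dist ?H u u \<le> 0"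
          using u by (intro graph_dist_le[OF path_between_singleton]) (auto simp: verts_bipartite_minus_star)
        then show ?thesis using True by (simp add: star_dist_def)
      next
        case False
        then show ?thesis
          using graph_dist_bipartite_minus_star_le[OF assms u v] x_pos[of v]
          by (simp add: mult_right_mono)
      qed
    qed
    also have "\<dots> = (\<Sum>v<2 * m. star_dist m r u v * x v) - 2 * x u"
      using u by (simp add: sum_subtractf)
    also have "\<dots> \<le> (3 * real m + 1) * x u"
    proof -
      consider "u = 0" | "0 < u" "u < m" | "m \<le> u" "u < m + r" | "m + r \<le> u" by linarith
      then show ?thesis
      proof cases
        case 1
        have "(\<Sum>v<2 * m. star_dist m r u v * x v) = 2 * (5 / 3) + (real m - 1) * 2
            + real r * (3 * (1 + 1 / real m)) + (real m - real r) * 1"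
          using assms 1 by (intro sum_star_classes) (auto simp: x_def star_dist_def)
        moreover have "x u = 5 / 3" using 1 by (simp add: x_def)
        ultimately show ?thesis unfolding rz using rm by (simp add: algebra_simps)
      next
        case 2
        have "(\<Sum>v<2 * m. star_dist m r u v * x v) = 2 * (5 / 3) + (real m - 1) * 2
            + real r * (1 * (1 + 1 / real m)) + (real m - real r) * 1"
          using assms 2 by (intro sum_star_classes) (auto simp: x_def star_dist_def)
        moreover have "x u = 1" using 2 by (simp add: x_def)
        ultimately show ?thesis unfolding rz using rm by (simp add: algebra_simps)
      next
        case 3
        have "(\<Sum>v<2 * m. star_dist m r u v * x v) = 3 * (5 / 3) + (real m - 1) * 1
            + real r * (2 * (1 + 1 / real m)) + (real m - real r) * 2"
          using assms 3 by (intro sum_star_classes) (auto simp: x_def star_dist_def)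
        moreover have "(3 * real m + 1) * x u = 3 * real m + 4 + 1 / real m" "x u = 1 + 1 / real m"
          using 3 assms by (auto simp: x_def field_simps)
        ultimately show ?thesis unfolding rz using rm q3 by (simp add: algebra_simps)
      next
        case 4
        have "(\<Sum>v<2 * m. star_dist m r u v * x v) = 1 * (5 / 3) + (real m - 1) * 1
            + real r * (2 * (1 + 1 / real m)) + (real m - real r) * 2"
          using assms 4 u by (intro sum_star_classes) (auto simp: x_def star_dist_def)
        moreover have "x u = 1" using 4 assms by (simp add: x_def)
        ultimately show ?thesis unfolding rz using rm by (simp add: algebra_simps)
      qed
    qed
    finally show "(\<Sum>v\<in>verts ?H. real (graph_dist ?H u v) * x v) \<le> (3 * real m + 1) * x u" .
  qed (use assms x_pos in \<open>auto simp: verts_bipartite_minus_star lessThan_empty_iff\<close>)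
qed

theorem theorem1p6:
  fixes G :: "'a ugraph" and k n :: nat
  assumes "k \<ge> 2"
    and "simple_graph G"
    and "connected_graph G"
    and "balanced_bipartite G"
    and "n = card (verts G)"
    and "n \<ge> 4 * k + 8"
    and "min_degree G \<ge> k + 2"
    and "distance_spectral_radius G
           \<le> distance_spectral_radius (bipartite_minus_star (n div 2) (n div 2 - k + 1))"
  shows "property_P k (min_degree G) G"
proof -
  obtain A B where AB: "A \<union> B = verts G" "A \<inter> B = {}" "card A = card B"
    and bip_all: "\<forall>e\<in>edges G. \<exists>a\<in>A. \<exists>b\<in>B. e = {a, b}"
    using assms(4) unfolding balanced_bipartite_def by (elim exE conjE)
  note bip = bspec[OF bip_all]
  define m where "m = card A"
  \<comment> \<open>For this \<open>K\<close> the hypotheses on degree and order become minimum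
    degree at least K + 1 and m >= 2K + 2, as \<open>dense_bipartite_cuts\<close> asks.\<close>
  define K where "K = k + 1"
  have fin: "finite (verts G)" using assms(2) by (simp add: simple_graph_def)
  then have "finite (A \<union> B)" by (simp add: AB(1))
  then have finAB: "finite A" "finite B" by simp_all
  have card: "card A = m" "card B = m" using AB(3) by (simp_all add: m_def)
  have n: "n = 2 * m"
    using assms(5) card card_Un_disjoint[OF finAB AB(2)] by (simp add: AB(1))
  have K: "2 \<le> K" "2 * K + 2 \<le> m" using assms(1,6) n by (auto simp: K_def)
  have ne: "verts G \<noteq> {}" using assms(3) by (simp add: connected_graph_def)
  have deg: "min_degree G \<le> card {e \<in> edges G. v \<in> e}" if "v \<in> verts G" for v
    using that fin by (auto simp: min_degree_def simp flip: vertex_degree_def)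
  \<comment> \<open>Here k >= 2 together with k < m makes the number of deleted edges, m - k + 1,
    smaller than \<open>m\<close>.\<close>
  have "distance_spectral_radius (bipartite_minus_star m (m - k + 1)) \<le> 3 * real m + 1"
    using assms(1) K by (intro distance_spectral_radius_bipartite_minus_star_le) (auto simp: K_def)
  then have "distance_spectral_radius G \<le> 3 * real m + 1" using assms(8) n by simp
  then have "distance_spectral_radius G * (2 * real m) \<le> (3 * real m + 1) * (2 * real m)"
    by (intro mult_right_mono) auto
  moreover have "10 * (real m)\<^sup>2 - 4 * real m - 4 * real (card (edges G))
      \<le> distance_spectral_radius G * (2 * real m)"
    using bip AB(2) assms(3,2) AB(1)[symmetric] card
    by (rule distance_spectral_radius_bipartite_ge)
  ultimately have "2 * (real m)\<^sup>2 \<le> 2 * real (card (edges G)) + 3 * real m"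
    by (simp add: algebra_simps power2_eq_square)
  then have "real (2 * m\<^sup>2) \<le> real (2 * card (edges G) + 3 * m)" by simp
  then have dense: "2 * m\<^sup>2 \<le> 2 * card (edges G) + 3 * m" by (simp only: of_nat_le_iff)
  have edges: "edges_on (verts G) (edges G)" using assms(2) by (rule simple_graph_edges_on)
  have "K * (card P - 1) \<le> card {e \<in> edges G. \<not> (\<exists>U\<in>P. e \<subseteq> U)}" if "partition_on (verts G) P" for P
  proof -
    have "K + 1 \<le> card {e \<in> edges G. v \<in> e}" if "v \<in> A \<union> B" for v
      using deg[of v] assms(7) that AB(1) by (simp add: K_def)
    moreover have "partition_on (A \<union> B) P" using that AB(1) by simp
    ultimately show ?thesis
      using dense_bipartite_cuts[OF finAB AB(2) card bip dense _ K, of P] by (simp add: cross_edges_def)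
  qed
  from tree_packing[OF fin ne edges this]
  obtain F where F: "packing (edges G) K F"
      "\<And>i u v. i < K \<Longrightarrow> u \<in> verts G \<Longrightarrow> v \<in> verts G \<Longrightarrow> (u, v) \<in> linked (F i)"
    by blast
  define T where "T i = \<lparr>verts = verts G, edges = F i\<rparr>" for i
  have tree: "spanning_tree_of (T i) G" if "i < K" for i
    unfolding T_def using F that by (intro spanning_tree_of_forest assms(2) ne edges) (auto simp: packing_def)
  have disj: "edges (T i) \<inter> edges (T j) = {}" if "i < K" "j < K" "i \<noteq> j" for i j
    using packing_disjoint[OF F(1) that] by (simp add: T_def)
  have card_T: "card (edges (T k)) + 1 = card (verts G)"
  proof -
    have Fk: "F k \<subseteq> edges G" "forest (F k)" using F(1) by (auto simp: packing_def K_def)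
    have "edges G \<subseteq> Pow (verts G)" using assms(2) by (auto simp: simple_graph_def)
    then have "finite (F k)" using Fk(1) fin by (meson finite_Pow_iff finite_subset)
    moreover have "edges_on (verts G) (F k)" using edges Fk(1) by (rule edges_on_subset)
    ultimately have "card (F k) + card (comps (verts G) (F k)) = card (verts G)"
      using fin Fk(2) by (intro forest_card_comps)
    moreover have "card (comps (verts G) (F k)) = 1"
    proof -
      obtain v where v: "v \<in> verts G" using ne by blast
      have "linked (F k) `` {u} = linked (F k) `` {v}" if "u \<in> verts G" for u
        using F(2)[of k u v] that v by (simp add: linked_class_eq_iff K_def)
      then have "comps (verts G) (F k) = {linked (F k) `` {v}}" using v unfolding comps_def by blast
      then show ?thesis by simp
    qed
    ultimately show ?thesis by (simp add: T_def)
  qed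
  show ?thesis
    unfolding property_P_def
  \<comment> \<open>With \<open>T k\<close> as the forest, clause (c) is vacuous, and its n - 1 > 0
    edges exceed the fraction (d - 1)/d of n - 1.\<close>
  proof (intro exI[of _ T] exI[of _ "T k"] conjI)
    show "real (card (edges (T k)))
        > (real (min_degree G) - 1) / real (min_degree G) * (real (card (verts G)) - 1)"
    proof -
      have "real (card (verts G)) - 1 = real (card (edges (T k)))" using card_T by linarith
      moreover have "0 < real (card (edges (T k)))" using card_T assms(5) n K by simp
      moreover have "0 < real (min_degree G)" using assms(7) by simp
      ultimately show ?thesis by (simp add: field_simps)
    qed
  qed (use tree disj in \<open>auto simp: K_def spanning_tree_of_def\<close>)
qed

end
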